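(* Let $G$ be a second-countable locally compact non-compact abelian group, $S\subset G$, $1\le p<+\infty$, let $\Gamma\subset\mathbb{C}$ be such that $\Gamma\setminus\{0\}$ is non-empty, and let $\omega$ be a continuous $G$-admissible weight on $G$. Then there is a $(\Gamma,S)$-dense vector in $L^p(G,\omega)$ if and only if there exist two sequences $(s_n)_{n\ge1}\subset S$ and $(\lambda_n)_{n\ge1}\subset\Gamma\setminus\{0\}$ such that $$\lim_{n\to+\infty}\max\left\{|\lambda_n|\,\omega(s_n)\,;\,\frac1{|\lambda_n|}\,\omega(s_n^{-1})\right\}=0.$$
   Context: Let $\mu$ be a left Haar measure on $G$. A weight on $G$ is a positive measurable function $\omega:G\to(0,+\infty)$ that is locally $p$-integrable, i.e. $\int_K\omega^p\,d\mu<+\infty$ for every compact $K\subset G$. $L^p(G,\omega)$ is the space of measurable $f:G\to\mathbb{C}$ (modulo a.e. equality) with $\|f\|_{p,\omega}:=\left(\int_G|f(t)|^p\omega(t)^p\,d\mu(t)\right)^{1/p}<\infty$, with this norm. For $s\in G$, the left translation is $(T_sf)(t)=f(s^{-1}t)$. The weight $\omega$ is $G$-admissible if $M(s):=\operatorname{ess\,sup}_{t\in G}\omega(st)/\omega(t)<+\infty$ for all $s\in G$ (equivalently, $T_s$ is a bounded operator of $L^p(G,\omega)$ into itself for every $s\in G$). A vector $f\in L^p(G,\omega)$ is $(\Gamma,S)$-dense if $\{\lambda T_sf:\ \lambda\in\Gamma,\ s\in S\}$ is dense in $L^p(G,\omega)$. *)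

theory Defs
  imports "HOL-Probability.Essential_Supremum"
begin

text \<open>
  Groups are written additively, because the library's topological groups are: \<open>st\<close> becomes
  \<open>s + t\<close> and \<open>s\<^sup>-\<^sup>1\<close> becomes \<open>- s\<close>.
\<close>

text \<open>A left Haar measure is a nonzero left-invariant Radon measure on the Borel sets.\<close>

definition left_haar_measure :: "'g::{topological_group_add, t2_space} measure \<Rightarrow> bool" where
  "left_haar_measure \<mu> \<longleftrightarrow>
     sets \<mu> = sets borel \<and>
     emeasure \<mu> UNIV \<noteq> 0 \<and>
     (\<forall>K. compact K \<longrightarrow> emeasure \<mu> K < \<infinity>) \<and>
     (\<forall>A\<in>sets borel. emeasure \<mu> A = (INF U\<in>{U. open U \<and> A \<subseteq> U}. emeasure \<mu> U)) \<and>
     (\<forall>U. open U \<longrightarrow> emeasure \<mu> U = (SUP K\<in>{K. compact K \<and> K \<subseteq> U}. emeasure \<mu> K)) \<and>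
     (\<forall>s. \<forall>A\<in>sets borel. emeasure \<mu> ((\<lambda>t. s + t) ` A) = emeasure \<mu> A)"

definition weight :: "'g::topological_group_add measure \<Rightarrow> real \<Rightarrow> ('g \<Rightarrow> real) \<Rightarrow> bool" where
  "weight \<mu> p \<omega> \<longleftrightarrow>
     (\<forall>t. 0 < \<omega> t) \<and>
     \<omega> \<in> borel_measurable \<mu> \<and>
     (\<forall>K. compact K \<longrightarrow> (\<integral>\<^sup>+t\<in>K. ennreal (\<omega> t powr p) \<partial>\<mu>) < \<infinity>)"

definition admissible :: "'g::topological_group_add measure \<Rightarrow> ('g \<Rightarrow> real) \<Rightarrow> bool" where
  "admissible \<mu> \<omega> \<longleftrightarrow> (\<forall>s. esssup \<mu> (\<lambda>t. ereal (\<omega> (s + t) / \<omega> t)) < \<infinity>)"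

definition weighted_Lp_integral ::
    "'g measure \<Rightarrow> real \<Rightarrow> ('g \<Rightarrow> real) \<Rightarrow> ('g \<Rightarrow> complex) \<Rightarrow> ennreal" where
  "weighted_Lp_integral \<mu> p \<omega> f = (\<integral>\<^sup>+t. ennreal (cmod (f t) powr p * \<omega> t powr p) \<partial>\<mu>)"

text \<open>
  Elements of \<open>L\<^sup>p(G, \<omega>)\<close> are represented by functions rather than by classes modulo a.e.
  equality. The norm below is therefore a seminorm, whose value depends only on the class of \<open>f\<close>.
\<close>

definition weighted_Lp ::
    "'g measure \<Rightarrow> real \<Rightarrow> ('g \<Rightarrow> real) \<Rightarrow> ('g \<Rightarrow> complex) set" where
  "weighted_Lp \<mu> p \<omega> = {f \<in> borel_measurable \<mu>. weighted_Lp_integral \<mu> p \<omega> f < \<infinity>}"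

text \<open>Only meaningful on \<open>weighted_Lp\<close>: \<open>enn2real\<close> sends an infinite integral to \<open>0\<close>.\<close>

definition weighted_Lp_norm ::
    "'g measure \<Rightarrow> real \<Rightarrow> ('g \<Rightarrow> real) \<Rightarrow> ('g \<Rightarrow> complex) \<Rightarrow> real" where
  "weighted_Lp_norm \<mu> p \<omega> f = enn2real (weighted_Lp_integral \<mu> p \<omega> f) powr (1 / p)"

definition left_translation :: "'g::group_add \<Rightarrow> ('g \<Rightarrow> complex) \<Rightarrow> 'g \<Rightarrow> complex" where
  "left_translation s f = (\<lambda>t. f (- s + t))"

definition weighted_Lp_dense ::
    "'g measure \<Rightarrow> real \<Rightarrow> ('g \<Rightarrow> real) \<Rightarrow> ('g \<Rightarrow> complex) set \<Rightarrow> bool" where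
  "weighted_Lp_dense \<mu> p \<omega> A \<longleftrightarrow>
     A \<subseteq> weighted_Lp \<mu> p \<omega> \<and>
     (\<forall>g\<in>weighted_Lp \<mu> p \<omega>. \<forall>\<epsilon>>0. \<exists>h\<in>A. weighted_Lp_norm \<mu> p \<omega> (\<lambda>t. h t - g t) < \<epsilon>)"

definition dense_vector ::
    "'g::group_add measure \<Rightarrow> real \<Rightarrow> ('g \<Rightarrow> real) \<Rightarrow> complex set \<Rightarrow> 'g set \<Rightarrow> ('g \<Rightarrow> complex) \<Rightarrow> bool"
  where
  "dense_vector \<mu> p \<omega> \<Gamma> S f \<longleftrightarrow>
     f \<in> weighted_Lp \<mu> p \<omega> \<and>
     weighted_Lp_dense \<mu> p \<omega> {(\<lambda>t. c * left_translation s f t) | c s. c \<in> \<Gamma> \<and> s \<in> S}"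

end

theory Submission
  imports Defs
begin

text \<open>
  Put \<open>I(f) = \<integral> |f|\<^sup>p \<omega>\<^sup>p d\<mu>\<close>. Since \<open>\<omega>\<close> is continuous and \<open>\<mu>\<close> has full support, admissibility
  gives \<open>\<omega> (s + t) \<le> M(s) \<omega> t\<close> everywhere, and \<open>G\<close> is exhausted by compact sets on which
  \<open>M(s)\<close> and \<open>M(- s)\<close> are bounded.

  Necessity: let \<open>K\<close> be such a compact set of positive measure and choose \<open>a\<close> outside the compact
  set \<open>(K - K) - (K - K)\<close>. As \<open>G\<close> is abelian, some \<open>f' = c' T\<^bsub>s'\<^esub> f\<close> close to the indicator of \<open>K\<close> is
  again dense, so some \<open>c T\<^sub>s f'\<close> is close to the indicator of \<open>K \<union> (a + K)\<close>. No translate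
  \<open>s + K\<close> can meet both pieces, which forces \<open>s + K\<close> to be disjoint from both of them.
  Comparing the two approximations on \<open>K\<close> and on \<open>s + K\<close> bounds \<open>\<omega> (- s) / |c|\<close> and \<open>|c| \<omega> s\<close>.

  Sufficiency: there is a countable dense set of functions \<open>g\<close> with \<open>I(T\<^sub>s g) \<le> C \<omega>(s)\<^sup>p\<close> for all
  \<open>s\<close>. If \<open>g\<^sub>k\<close> lists each of them infinitely often, then for a sufficiently sparse subsequence
  \<open>f = \<Sum>\<^sub>k c\<^sub>k\<inverse> T\<^bsub>- s\<^sub>k\<^esub> g\<^sub>k\<close> satisfies \<open>c\<^sub>j T\<^bsub>s\<^sub>j\<^esub> f - g\<^sub>j \<longrightarrow> 0\<close>.
\<close>

section \<open>Haar measure and the bounds that admissibility provides\<close>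

locale admissible_weight =
  fixes \<mu> :: "'g::{topological_ab_group_add, t2_space, second_countable_topology} measure"
    and p :: real
    and \<omega> :: "'g \<Rightarrow> real"
  assumes loc_compact: "locally_compact_space (euclidean :: 'g topology)"
    and haar: "left_haar_measure \<mu>"
    and p_ge_1: "1 \<le> p"
    and wt: "weight \<mu> p \<omega>"
    and cont: "continuous_on UNIV \<omega>"
    and adm: "admissible \<mu> \<omega>"
begin

lemma sets_mu [measurable_cong, simp]: "sets \<mu> = sets borel"
  by (rule haar[unfolded left_haar_measure_def, THEN conjunct1])

lemma space_mu [simp]: "space \<mu> = UNIV"
  using sets_eq_imp_space_eq[OF sets_mu] by simp

lemma p_pos: "0 < p"
  using p_ge_1 by simp

lemma weight_pos: "0 < \<omega> t"
  using wt by (simp add: weight_def)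

lemma weight_measurable [measurable]: "\<omega> \<in> borel_measurable borel"
  using cont by (rule borel_measurable_continuous_onI)

lemma shift_measurable [measurable]: "(+) s \<in> borel \<rightarrow>\<^sub>M (borel :: 'g measure)"
  by (intro borel_measurable_continuous_onI continuous_intros)

lemma shift_diff_measurable [measurable]: "(\<lambda>t. t - s) \<in> borel \<rightarrow>\<^sub>M (borel :: 'g measure)"
  by (intro borel_measurable_continuous_onI continuous_intros)

lemma shift_set [measurable]: "A \<in> sets borel \<Longrightarrow> (+) s ` A \<in> sets (borel :: 'g measure)"
proof -
  assume A: "A \<in> sets borel"
  have "(+) s ` A = (+) (- s) -` A"
    by (force simp: image_iff)
  then show ?thesis
    using measurable_sets[OF shift_measurable A, of "- s"] by simp
qed

lemma emeasure_UNIV_nonzero: "emeasure \<mu> UNIV \<noteq> 0"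
  using haar[unfolded left_haar_measure_def] by (elim conjE)

lemma emeasure_outer:
  "A \<in> sets borel \<Longrightarrow> emeasure \<mu> A = (INF U\<in>{U. open U \<and> A \<subseteq> U}. emeasure \<mu> U)"
  using haar[unfolded left_haar_measure_def] by (elim conjE) (rule bspec)

lemma emeasure_shift: "A \<in> sets borel \<Longrightarrow> emeasure \<mu> ((+) s ` A) = emeasure \<mu> A"
  using haar[unfolded left_haar_measure_def] by (elim conjE) (drule spec, erule (1) bspec)

lemma emeasure_compact: "compact K \<Longrightarrow> emeasure \<mu> K < \<infinity>"
  using haar[unfolded left_haar_measure_def] by (elim conjE) (drule spec, erule (1) mp)

lemma distr_shift: "distr \<mu> borel ((+) s) = \<mu>"
proof (rule measure_eqI)
  fix A assume "A \<in> sets (distr \<mu> borel ((+) s))"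
  then have A: "A \<in> sets borel" by simp
  have "(+) s -` A = (+) (- s) ` A"
    by (force simp: image_iff)
  then show "emeasure (distr \<mu> borel ((+) s)) A = emeasure \<mu> A"
    using A emeasure_shift[OF A, of "- s"] by (simp add: emeasure_distr)
qed simp

lemma nn_integral_shift:
  assumes [measurable]: "g \<in> borel_measurable borel"
  shows "(\<integral>\<^sup>+t. g (s + t) \<partial>\<mu>) = (\<integral>\<^sup>+t. g t \<partial>\<mu>)"
proof -
  have "(\<integral>\<^sup>+t. g (s + t) \<partial>\<mu>) = (\<integral>\<^sup>+t. g t \<partial>distr \<mu> borel ((+) s))"
    by (subst nn_integral_distr) simp_all
  then show ?thesis
    by (simp add: distr_shift)
qed

text \<open>If \<open>U\<close> were null, so would be all its translates. They cover the group and,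
  by second countability, countably many of them suffice, so \<mu> would vanish.\<close>

lemma emeasure_open_nonzero:
  assumes "open U" "U \<noteq> {}"
  shows "emeasure \<mu> U \<noteq> 0"
proof
  assume null: "emeasure \<mu> U = 0"
  obtain u where u: "u \<in> U" using assms by blast
  have img: "(+) s ` U = (+) (- s) -` U" for s
    by (force simp: image_iff)
  have op: "open ((+) s ` U)" for s
    unfolding img by (intro open_vimage assms continuous_intros)
  obtain \<F> where \<F>: "\<F> \<subseteq> range (\<lambda>s. (+) s ` U)" "countable \<F>"
      "\<Union>\<F> = \<Union>(range (\<lambda>s. (+) s ` U))"
    by (rule Lindelof[of "range (\<lambda>s. (+) s ` U)"]) (use op in auto)
  have "x \<in> \<Union>(range (\<lambda>s. (+) s ` U))" for x
  proof -
    have "x = (x - u) + u" by simp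
    then show ?thesis using u by blast
  qed
  then have "UNIV = \<Union>\<F>" using \<F>(3) by blast
  moreover have "\<Union>\<F> \<in> null_sets \<mu>"
  proof -
    have "X \<in> null_sets \<mu>" if "X \<in> \<F>" for X
      using that \<F>(1) op emeasure_shift null assms(1) by (force simp: null_sets_def)
    then have "(\<Union>X\<in>\<F>. X) \<in> null_sets \<mu>"
      by (intro null_sets_UN' \<F>(2)) auto
    then show ?thesis by simp
  qed
  ultimately have "emeasure \<mu> UNIV = 0" by auto
  then show False using emeasure_UNIV_nonzero by simp
qed

text \<open>Admissibility bounds the ratio only almost everywhere. By continuity the exceptional set
  is open, and an open null set is empty.\<close>

lemma shift_bound:
  obtains C where "1 \<le> C" "\<And>t. \<omega> (s + t) \<le> C * \<omega> t"
proof -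
  define E where "E = esssup \<mu> (\<lambda>t. ereal (\<omega> (s + t) / \<omega> t))"
  define C where "C = max 1 (real_of_ereal E)"
  have E: "E < \<infinity>" using adm by (simp add: admissible_def E_def)
  have "AE t in \<mu>. ereal (\<omega> (s + t) / \<omega> t) \<le> E"
    unfolding E_def by (rule esssup_AE)
  then have ae: "AE t in \<mu>. \<omega> (s + t) \<le> C * \<omega> t"
  proof eventually_elim
    case (elim t)
    have "\<omega> (s + t) / \<omega> t \<le> C"
      using elim E by (cases E) (auto simp: C_def)
    then show ?case using weight_pos[of t] by (simp add: field_simps)
  qed
  have cont': "continuous_on UNIV (\<lambda>t. \<omega> (s + t))"
    by (rule continuous_on_compose2[OF cont]) (auto intro!: continuous_intros)
  let ?U = "{t. C * \<omega> t < \<omega> (s + t)}"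
  have op: "open ?U"
    by (intro open_Collect_less continuous_intros cont cont')
  have "emeasure \<mu> ?U = 0"
    using ae op by (subst (asm) AE_iff_measurable[where N = ?U]) (auto simp: not_le)
  then have "?U = {}" using emeasure_open_nonzero[OF op] by blast
  then have "\<omega> (s + t) \<le> C * \<omega> t" for t by (auto simp: not_less)
  then show thesis using that[of C] by (simp add: C_def)
qed

text \<open>Local compactness gives each point an open neighbourhood inside a compact set. By the
  Lindelof property countably many neighbourhoods cover the group; \<open>L n\<close> collects the
  first \<open>n\<close> of the compact sets.\<close>

lemma compact_exhaustion:
  obtains L :: "nat \<Rightarrow> 'g set" where "\<And>n. compact (L n)" "incseq L" "(\<Union>n. L n) = UNIV"
proof -
  have "\<forall>x::'g. \<exists>U K. open U \<and> compact K \<and> x \<in> U \<and> U \<subseteq> K"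
    using loc_compact by (simp add: locally_compact_space_def)
  then obtain U K where UK: "\<And>x::'g. open (U x) \<and> compact (K x) \<and> x \<in> U x \<and> U x \<subseteq> K x"
    by metis
  obtain \<F> where \<F>: "\<F> \<subseteq> range U" "countable \<F>" "\<Union>\<F> = \<Union>(range U)"
    by (rule Lindelof[of "range U"]) (use UK in auto)
  obtain X where X: "countable X" "\<F> = U ` X"
    using \<F>(1,2) by (metis countable_subset_image)
  have "X \<noteq> {}" using X \<F>(3) UK by fastforce
  define L where "L n = (\<Union>i<n. K (from_nat_into X i))" for n
  show thesis
  proof
    show "compact (L n)" for n unfolding L_def using UK by auto
    show "incseq L" unfolding L_def by (intro incseq_SucI UN_mono) auto
    have "x \<in> (\<Union>n. L n)" for x
    proof -
      obtain y where y: "y \<in> X" "x \<in> U y" using UK[of x] \<F>(3) X(2) by blast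
      obtain i where "from_nat_into X i = y"
        using from_nat_into_surj[OF X(1) y(1)] by blast
      then have "x \<in> L (Suc i)" using y UK[of y] by (auto simp: L_def)
      then show ?thesis by blast
    qed
    then show "(\<Union>n. L n) = UNIV" by blast
  qed
qed

text \<open>The set of \<open>t\<close> with M(t) and M(-t) at most \<open>n\<close> is closed,
  being an intersection over \<open>s\<close> of closed conditions on \<open>t\<close>. By
  \<open>shift_bound\<close> these sets increase to the whole group; intersecting them with a
  compact exhaustion keeps both properties.\<close>

lemma tame_exhaustion:
  obtains F :: "nat \<Rightarrow> 'g set" where
    "\<And>n. compact (F n)" "incseq F" "(\<Union>n. F n) = UNIV"
    "\<And>n t s. t \<in> F n \<Longrightarrow> \<omega> (t + s) \<le> real n * \<omega> s"
    "\<And>n t s. t \<in> F n \<Longrightarrow> \<omega> (- t + s) \<le> real n * \<omega> s"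
proof -
  obtain L :: "nat \<Rightarrow> 'g set"
    where L: "\<And>n. compact (L n)" "incseq L" "(\<Union>n. L n) = UNIV"
    by (rule compact_exhaustion) blast
  define E where "E n = {t. \<forall>s. \<omega> (t + s) \<le> real n * \<omega> s \<and> \<omega> (- t + s) \<le> real n * \<omega> s}" for n
  have cl: "closed (E n)" for n
  proof -
    have 1: "continuous_on UNIV (\<lambda>t. \<omega> (t + s))" "continuous_on UNIV (\<lambda>t. \<omega> (- t + s))" for s
      by (rule continuous_on_compose2[OF cont]; auto intro!: continuous_intros)+
    show ?thesis unfolding E_def
      by (intro closed_Collect_all closed_Collect_conj closed_Collect_le 1 continuous_intros)
  qed
  have incE: "E m \<subseteq> E n" if "m \<le> n" for m n
  proof
    fix t assume t: "t \<in> E m"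
    have "real m * \<omega> s \<le> real n * \<omega> s" for s
      using that weight_pos[of s] by (intro mult_right_mono) auto
    with t show "t \<in> E n" unfolding E_def by (auto intro: order_trans)
  qed
  have cov: "\<exists>n. t \<in> E n" for t
  proof -
    obtain C where C: "1 \<le> C" "\<And>s. \<omega> (t + s) \<le> C * \<omega> s" by (rule shift_bound[of t]) blast
    obtain C' where C': "1 \<le> C'" "\<And>s. \<omega> (- t + s) \<le> C' * \<omega> s" by (rule shift_bound[of "- t"]) blast
    obtain n :: nat where n: "C \<le> real n" "C' \<le> real n"
      using real_arch_simple[of "max C C'"] by auto
    have "C * \<omega> s \<le> real n * \<omega> s" "C' * \<omega> s \<le> real n * \<omega> s" for s
      using n weight_pos[of s] by (auto intro: mult_right_mono)
    then have "t \<in> E n" unfolding E_def using order_trans[OF C(2)] order_trans[OF C'(2)] by blast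
    then show ?thesis by blast
  qed
  show thesis
  proof (rule that[of "\<lambda>n. E n \<inter> L n"])
    show "compact (E n \<inter> L n)" for n by (intro closed_Int_compact cl L)
    show "incseq (\<lambda>n. E n \<inter> L n)"
      using incE L(2) by (auto simp: incseq_def) blast+
    have "t \<in> (\<Union>n. E n \<inter> L n)" for t
    proof -
      obtain m k where "t \<in> E m" "t \<in> L k" using cov[of t] L(3) by blast
      moreover have "L k \<subseteq> L (max m k)" using L(2) by (simp add: incseq_def)
      ultimately have "t \<in> E (max m k) \<inter> L (max m k)"
        using incE[of m "max m k"] by auto
      then show ?thesis by blast
    qed
    then show "(\<Union>n. E n \<inter> L n) = UNIV" by blast
  qed (auto simp: E_def)
qed

section \<open>The weighted integral\<close>

text \<open>The \<open>p\<close>-th power of the norm over \<open>X\<close>. Working in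
  \<open>ennreal\<close> and omitting the root keeps the estimates free of finiteness
  conditions.\<close>

definition pint :: "'g set \<Rightarrow> ('g \<Rightarrow> complex) \<Rightarrow> ennreal" where
  "pint X f = (\<integral>\<^sup>+t. ennreal ((cmod (f t) * \<omega> t) powr p) * indicator X t \<partial>\<mu>)"

lemma weighted_Lp_integral_eq: "weighted_Lp_integral \<mu> p \<omega> f = pint UNIV f"
  unfolding weighted_Lp_integral_def pint_def
  by (simp add: powr_mult weight_pos less_imp_le)

lemma weighted_Lp_eq: "weighted_Lp \<mu> p \<omega> = {f \<in> borel_measurable borel. pint UNIV f < \<infinity>}"
  unfolding weighted_Lp_def weighted_Lp_integral_eq
  by (simp cong: measurable_cong_sets)

text \<open>Substituting \<open>s + t\<close> for \<open>t\<close> leaves the integral unchanged, so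
  a pointwise comparison of \<open>f\<close> at \<open>t\<close> with \<open>g\<close> at
  \<open>s + t\<close> suffices. Most later estimates of translates go through this.\<close>

lemma pint_transfer:
  assumes [measurable]: "g \<in> borel_measurable borel" "Y \<in> sets borel"
    and b: "0 \<le> b"
    and le: "\<And>t. t \<in> X \<Longrightarrow> s + t \<in> Y \<and> cmod (f t) * \<omega> t \<le> b * (cmod (g (s + t)) * \<omega> (s + t))"
  shows "pint X f \<le> ennreal (b powr p) * pint Y g"
proof -
  let ?g = "\<lambda>t. ennreal ((cmod (g t) * \<omega> t) powr p) * indicator Y t"
  have "pint X f \<le> (\<integral>\<^sup>+t. ennreal (b powr p) * ?g (s + t) \<partial>\<mu>)"
    unfolding pint_def
  proof (rule nn_integral_mono)
    fix t
    show "ennreal ((cmod (f t) * \<omega> t) powr p) * indicator X t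
        \<le> ennreal (b powr p) * ?g (s + t)"
    proof (cases "t \<in> X")
      case True
      have "(cmod (f t) * \<omega> t) powr p \<le> (b * (cmod (g (s + t)) * \<omega> (s + t))) powr p"
        using le[OF True] weight_pos[of t] p_pos by (intro powr_mono2) auto
      also have "\<dots> = b powr p * (cmod (g (s + t)) * \<omega> (s + t)) powr p"
        using b weight_pos by (simp add: powr_mult less_imp_le)
      finally show ?thesis
        using True le[OF True] by (simp add: ennreal_mult[symmetric] ennreal_leI)
    qed simp
  qed
  also have "\<dots> = ennreal (b powr p) * (\<integral>\<^sup>+t. ?g (s + t) \<partial>\<mu>)"
    by (rule nn_integral_cmult) measurable
  also have "(\<integral>\<^sup>+t. ?g (s + t) \<partial>\<mu>) = pint Y g"
    unfolding pint_def by (rule nn_integral_shift) measurable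
  finally show ?thesis .
qed

lemma pint_mono:
  assumes "\<And>t. t \<in> X \<Longrightarrow> t \<in> Y \<and> cmod (f t) \<le> cmod (g t)"
  shows "pint X f \<le> pint Y g"
  unfolding pint_def
proof (rule nn_integral_mono)
  fix t
  have "(cmod (f t) * \<omega> t) powr p \<le> (cmod (g t) * \<omega> t) powr p" if "t \<in> X"
    using assms[OF that] weight_pos[of t] p_pos
    by (intro powr_mono2 mult_right_mono) auto
  then show "ennreal ((cmod (f t) * \<omega> t) powr p) * indicator X t
    \<le> ennreal ((cmod (g t) * \<omega> t) powr p) * indicator Y t"
    using assms[of t] by (auto split: split_indicator intro: ennreal_leI)
qed

lemma pint_cmult:
  assumes [measurable]: "f \<in> borel_measurable borel" "X \<in> sets borel"
  shows "pint X (\<lambda>t. c * f t) = ennreal (cmod c powr p) * pint X f"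
proof -
  have "pint X (\<lambda>t. c * f t) = (\<integral>\<^sup>+t. ennreal (cmod c powr p) *
      (ennreal ((cmod (f t) * \<omega> t) powr p) * indicator X t) \<partial>\<mu>)"
    unfolding pint_def
  proof (rule nn_integral_cong)
    fix t
    have "(cmod (c * f t) * \<omega> t) powr p = cmod c powr p * (cmod (f t) * \<omega> t) powr p"
      by (subst powr_mult[symmetric]) (simp_all add: norm_mult mult.assoc)
    then show "ennreal ((cmod (c * f t) * \<omega> t) powr p) * indicator X t = ennreal (cmod c powr p) *
      (ennreal ((cmod (f t) * \<omega> t) powr p) * indicator X t)"
      by (simp add: ennreal_mult mult.assoc)
  qed
  also have "\<dots> = ennreal (cmod c powr p) * pint X f"
    unfolding pint_def by (rule nn_integral_cmult) measurable
  finally show ?thesis .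
qed

text \<open>\<open>a + b\<close> is at most twice the maximum. The factor 2^p replaces Minkowski's
  inequality, which is affordable because only smallness matters.\<close>

lemma powr_sum_le:
  assumes "0 \<le> a" "0 \<le> b"
  shows "(a + b) powr p \<le> 2 powr p * (a powr p + b powr p)"
proof -
  have "(a + b) powr p \<le> (2 * max a b) powr p"
    using assms p_pos by (intro powr_mono2) auto
  also have "\<dots> = 2 powr p * max a b powr p"
    using assms by (intro powr_mult)
  also have "max a b powr p \<le> a powr p + b powr p"
    by (simp add: max_def)
  finally show ?thesis by simp
qed

lemma pint_triangle:
  assumes [measurable]: "f \<in> borel_measurable borel" "g \<in> borel_measurable borel" "X \<in> sets borel"
    and le: "\<And>t. t \<in> X \<Longrightarrow> cmod (h t) \<le> cmod (f t) + cmod (g t)"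
  shows "pint X h \<le> ennreal (2 powr p) * (pint X f + pint X g)"
proof -
  let ?i = "\<lambda>f t. ennreal ((cmod (f t) * \<omega> t) powr p) * indicator X t"
  have "pint X h \<le> (\<integral>\<^sup>+t. ennreal (2 powr p) * (?i f t + ?i g t) \<partial>\<mu>)"
    unfolding pint_def
  proof (rule nn_integral_mono)
    fix t
    show "?i h t \<le> ennreal (2 powr p) * (?i f t + ?i g t)"
    proof (cases "t \<in> X")
      case True
      have "(cmod (h t) * \<omega> t) powr p \<le> (cmod (f t) * \<omega> t + cmod (g t) * \<omega> t) powr p"
        using le[OF True] weight_pos[of t] p_pos
        by (intro powr_mono2) (auto simp flip: distrib_right)
      also have "\<dots> \<le> 2 powr p * ((cmod (f t) * \<omega> t) powr p + (cmod (g t) * \<omega> t) powr p)"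
        using weight_pos[of t] by (intro powr_sum_le) auto
      finally show ?thesis using True
        by (simp add: ennreal_plus[symmetric] ennreal_mult[symmetric] ennreal_leI del: ennreal_plus)
    qed simp
  qed
  also have "\<dots> = ennreal (2 powr p) * (pint X f + pint X g)"
    unfolding pint_def by (simp add: nn_integral_cmult nn_integral_add)
  finally show ?thesis .
qed

lemma pint_triangle_real:
  assumes "f \<in> borel_measurable borel" "g \<in> borel_measurable borel" "X \<in> sets borel"
    and "\<And>t. t \<in> X \<Longrightarrow> cmod (h t) \<le> cmod (f t) + cmod (g t)"
    and "pint X f \<le> ennreal a" "pint X g \<le> ennreal b" "0 \<le> a" "0 \<le> b"
  shows "pint X h \<le> ennreal (2 powr p * (a + b))"
proof -
  have "pint X h \<le> ennreal (2 powr p) * (ennreal a + ennreal b)"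
    by (rule order_trans[OF pint_triangle[OF assms(1-4)]]) (use assms in \<open>auto intro!: mult_left_mono add_mono\<close>)
  also have "\<dots> = ennreal (2 powr p * (a + b))"
    using assms by (simp add: ennreal_mult)
  finally show ?thesis .
qed

lemma left_translation_measurable [measurable]:
  assumes [measurable]: "f \<in> borel_measurable borel"
  shows "left_translation s f \<in> borel_measurable (borel :: 'g measure)"
  unfolding left_translation_def by measurable

lemma pint_translation_le:
  assumes [measurable]: "f \<in> borel_measurable borel"
    and C: "0 \<le> C" "\<And>t. \<omega> (s + t) \<le> C * \<omega> t"
  shows "pint UNIV (left_translation s f) \<le> ennreal (C powr p) * pint UNIV f"
proof (rule pint_transfer[where s = "- s"])
  fix t
  have "\<omega> t \<le> C * \<omega> (- s + t)" using C(2)[of "- s + t"] by (simp add: add.assoc[symmetric])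
  from mult_left_mono[OF this, of "cmod (f (- s + t))"]
  show "- s + t \<in> UNIV \<and> cmod (left_translation s f t) * \<omega> t
      \<le> C * (cmod (f (- s + t)) * \<omega> (- s + t))"
    by (simp add: left_translation_def mult.left_commute)
qed (use C in auto)

lemma pint_translation_finite:
  assumes "f \<in> borel_measurable borel" "pint UNIV f < \<infinity>"
  shows "pint UNIV (\<lambda>t. c * left_translation s f t) < \<infinity>"
proof -
  obtain C where C: "1 \<le> C" "\<And>t. \<omega> (s + t) \<le> C * \<omega> t" by (rule shift_bound[of s]) blast
  have "pint UNIV (left_translation s f) \<le> ennreal (C powr p) * pint UNIV f"
    using assms C by (intro pint_translation_le) auto
  also have "\<dots> < \<infinity>" using assms by (simp add: ennreal_mult_less_top)
  finally show ?thesis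
    using assms by (simp add: pint_cmult left_translation_measurable ennreal_mult_less_top)
qed

text \<open>Finiteness matters here: an infinite integral would get norm 0 from
  \<open>enn2real\<close>.\<close>

lemma norm_less_iff:
  assumes "pint UNIV f < \<infinity>" "0 < \<epsilon>"
  shows "weighted_Lp_norm \<mu> p \<omega> f < \<epsilon> \<longleftrightarrow> pint UNIV f < ennreal (\<epsilon> powr p)"
proof -
  obtain r where r: "pint UNIV f = ennreal r" "0 \<le> r"
    using assms(1) by (cases "pint UNIV f") auto
  have "r powr (1 / p) < \<epsilon> \<longleftrightarrow> r < \<epsilon> powr p"
  proof
    assume "r powr (1 / p) < \<epsilon>"
    then have "(r powr (1 / p)) powr p < \<epsilon> powr p" using p_pos by (intro powr_less_mono2) auto
    then show "r < \<epsilon> powr p" using p_pos r by (simp add: powr_powr)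
  next
    assume "r < \<epsilon> powr p"
    then have "r powr (1 / p) < (\<epsilon> powr p) powr (1 / p)" using p_pos r
      by (intro powr_less_mono2) auto
    then show "r powr (1 / p) < \<epsilon>" using p_pos assms by (simp add: powr_powr)
  qed
  then show ?thesis using r assms(2)
    by (simp add: weighted_Lp_norm_def weighted_Lp_integral_eq ennreal_less_iff)
qed

text \<open>From here on distances are measured by \<open>pint\<close>, that is, by
  \<open>p\<close>-th powers; this is harmless because \<epsilon> is arbitrary.\<close>

lemma dense_vector_iff:
  "dense_vector \<mu> p \<omega> \<Gamma> S f \<longleftrightarrow> f \<in> borel_measurable borel \<and> pint UNIV f < \<infinity> \<and>
    (\<forall>g \<epsilon>. g \<in> borel_measurable borel \<longrightarrow> pint UNIV g < \<infinity> \<longrightarrow> 0 < \<epsilon> \<longrightarrow>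
      (\<exists>c\<in>\<Gamma>. \<exists>s\<in>S. pint UNIV (\<lambda>t. c * left_translation s f t - g t) < ennreal \<epsilon>))"
  (is "?L \<longleftrightarrow> ?R")
proof -
  have diff: "pint UNIV (\<lambda>t. c * left_translation s f t - g t) < \<infinity>"
    if "f \<in> borel_measurable borel" "pint UNIV f < \<infinity>" "g \<in> borel_measurable borel" "pint UNIV g < \<infinity>"
    for c s g
  proof -
    have "pint UNIV (\<lambda>t. c * left_translation s f t - g t)
      \<le> ennreal (2 powr p) * (pint UNIV (\<lambda>t. c * left_translation s f t) + pint UNIV g)"
      using that by (intro pint_triangle borel_measurable_times left_translation_measurable)
        (auto intro: norm_triangle_ineq4)
    also have "\<dots> < \<infinity>"
      using that pint_translation_finite[of f c s] by (simp add: ennreal_mult_less_top)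
    finally show ?thesis .
  qed
  show ?thesis
  proof
    assume L: ?L
    then have f: "f \<in> borel_measurable borel" "pint UNIV f < \<infinity>"
      and d: "\<And>g \<epsilon>. g \<in> weighted_Lp \<mu> p \<omega> \<Longrightarrow> 0 < \<epsilon> \<Longrightarrow>
        \<exists>c\<in>\<Gamma>. \<exists>s\<in>S. weighted_Lp_norm \<mu> p \<omega> (\<lambda>t. c * left_translation s f t - g t) < \<epsilon>"
      unfolding dense_vector_def weighted_Lp_dense_def by (auto simp: weighted_Lp_eq) blast
    show ?R
    proof (intro conjI f allI impI)
      fix g and \<epsilon> :: real
      assume g: "g \<in> borel_measurable borel" "pint UNIV g < \<infinity>" and "0 < \<epsilon>"
      then obtain c s where "c \<in> \<Gamma>" "s \<in> S"
        "weighted_Lp_norm \<mu> p \<omega> (\<lambda>t. c * left_translation s f t - g t) < \<epsilon> powr (1 / p)"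
        using d[of g "\<epsilon> powr (1 / p)"] by (auto simp: weighted_Lp_eq)
      then show "\<exists>c\<in>\<Gamma>. \<exists>s\<in>S. pint UNIV (\<lambda>t. c * left_translation s f t - g t) < ennreal \<epsilon>"
        using norm_less_iff[OF diff[OF f g], of "\<epsilon> powr (1 / p)"] \<open>0 < \<epsilon>\<close> p_pos
        by (auto simp: powr_powr)
    qed
  next
    assume R: ?R
    then have f: "f \<in> borel_measurable borel" "pint UNIV f < \<infinity>" by auto
    have tr: "(\<lambda>t. c * left_translation s f t) \<in> weighted_Lp \<mu> p \<omega>" for c s
      using pint_translation_finite[OF f] f
      by (simp add: weighted_Lp_eq borel_measurable_times left_translation_measurable)
    show ?L
      unfolding dense_vector_def weighted_Lp_dense_def
    proof (intro conjI ballI allI impI)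
      show "f \<in> weighted_Lp \<mu> p \<omega>" using f by (simp add: weighted_Lp_eq)
      show "{\<lambda>t. c * left_translation s f t |c s. c \<in> \<Gamma> \<and> s \<in> S} \<subseteq> weighted_Lp \<mu> p \<omega>"
        using tr by auto
      fix g and \<epsilon> :: real
      assume "g \<in> weighted_Lp \<mu> p \<omega>" and \<epsilon>: "0 < \<epsilon>"
      then have g: "g \<in> borel_measurable borel" "pint UNIV g < \<infinity>" by (auto simp: weighted_Lp_eq)
      then obtain c s where cs: "c \<in> \<Gamma>" "s \<in> S"
        "pint UNIV (\<lambda>t. c * left_translation s f t - g t) < ennreal (\<epsilon> powr p)"
        using R \<epsilon> by (metis powr_gt_zero less_irrefl)
      then have "weighted_Lp_norm \<mu> p \<omega> (\<lambda>t. c * left_translation s f t - g t) < \<epsilon>"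
        using norm_less_iff[OF diff[OF f g] \<epsilon>] by simp
      then show "\<exists>h\<in>{\<lambda>t. c * left_translation s f t |c s. c \<in> \<Gamma> \<and> s \<in> S}.
          weighted_Lp_norm \<mu> p \<omega> (\<lambda>t. h t - g t) < \<epsilon>"
        using cs(1,2) by auto
    qed
  qed
qed

end

section \<open>Necessity: what a dense vector forces on the weight\<close>

lemma compact_set_diff:
  fixes A B :: "'a::topological_group_add set"
  assumes "compact A" "compact B"
  shows "compact {x - y | x y. x \<in> A \<and> y \<in> B}"
proof -
  have "{x - y | x y. x \<in> A \<and> y \<in> B} = (\<lambda>z. fst z - snd z) ` (A \<times> B)"
    by force
  then show ?thesis
    using assms by (auto intro!: compact_continuous_image compact_Times continuous_intros)
qed

context admissible_weight
begin

text \<open>Local integrability makes the value finite; positivity of \<omega> on a set of positive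
  measure makes it nonzero.\<close>

lemma pint_one_compact:
  assumes "compact K" "emeasure \<mu> K \<noteq> 0"
  obtains W where "0 < W" "pint K (\<lambda>_. 1) = ennreal W"
proof -
  have K [measurable]: "K \<in> sets borel" using assms by (simp add: borel_compact)
  have "pint K (\<lambda>_. 1) < \<infinity>"
    using wt assms(1) weight_pos by (simp add: weight_def pint_def)
  moreover have "pint K (\<lambda>_. 1) \<noteq> 0"
  proof
    assume "pint K (\<lambda>_. 1) = 0"
    then have "AE t in \<mu>. ennreal ((cmod 1 * \<omega> t) powr p) * indicator K t = 0"
      unfolding pint_def by (subst (asm) nn_integral_0_iff_AE) measurable
    then have "AE t in \<mu>. t \<notin> K"
    proof eventually_elim
      case (elim t)
      then show ?case using weight_pos[of t] by (auto split: split_indicator_asm)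
    qed
    then show False using assms(2) by (simp add: AE_iff_measurable[where N = K])
  qed
  ultimately show thesis
    by (cases "pint K (\<lambda>_. 1)") (auto intro!: that simp: less_le)
qed

lemma pint_const:
  assumes "X \<in> sets borel"
  shows "pint X (\<lambda>_. c) = ennreal (cmod c powr p) * pint X (\<lambda>_. 1)"
  using pint_cmult[of "\<lambda>_. 1" X c] assms by simp

lemma pint_indicator: "pint UNIV (indicator X) = pint X (\<lambda>_. 1)"
  unfolding pint_def using p_pos by (intro nn_integral_cong) (auto split: split_indicator)

text \<open>If \<open>s\<close> were such that \<open>s + K\<close> misses one of the pieces of the target, then \<open>c T\<^sub>s f\<close>
  would be negligible there, since \<open>f\<close> is concentrated on \<open>K\<close>; the factor \<open>c\<close> cannot
  compensate for this because \<open>c T\<^sub>s f\<close> is bounded in norm.\<close>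

lemma close_pair_excludes_shift:
  assumes [measurable]: "K \<in> sets borel" "X \<in> sets borel" "Z \<in> sets borel" "f \<in> borel_measurable borel"
    and f: "pint UNIV (\<lambda>t. f t - indicator K t) \<le> ennreal \<delta>"
    and cf: "pint UNIV (\<lambda>t. c * f (- s + t) - indicator X t) \<le> ennreal \<delta>"
    and WG: "pint K (\<lambda>_. 1) = ennreal W" "0 < W" "pint X (\<lambda>_. 1) \<le> ennreal G" "0 \<le> G"
    and Z: "Z \<subseteq> X" "\<And>t. t \<in> Z \<Longrightarrow> - s + t \<notin> K" "pint Z (\<lambda>_. 1) = ennreal V" "0 < V"
    and C: "0 \<le> C" "\<And>t. \<omega> (s + t) \<le> C * \<omega> t" "\<And>t. \<omega> (- s + t) \<le> C * \<omega> t"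
    and \<delta>: "0 < \<delta>" "\<delta> \<le> 1" "2 * 2 powr p * \<delta> \<le> W" "4 * 2 powr p * \<delta> \<le> V"
      "4 * 2 powr p * (2 * 2 powr p * 2 powr p * C powr p * (1 + G) / W) * C powr p * \<delta> \<le> V"
  shows False
proof -
  have [simp]: "(\<lambda>t. c * f (t - s)) \<in> borel_measurable borel"
    "(\<lambda>t. c * f (t - s) - indicator X t) \<in> borel_measurable borel"
    by measurable
  let ?P = "2 powr p" and ?y = "cmod c powr p" and ?C = "C powr p"
  \<comment> \<open>The target has size at most \<open>G\<close>, so its approximation is
    bounded.\<close>
  have "pint UNIV (\<lambda>t. c * f (- s + t)) \<le> ennreal (?P * (\<delta> + G))"
    by (rule pint_triangle_real[OF _ _ _ _ cf, of "indicator X"])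
       (use WG \<delta> norm_triangle_sub[of "c * f (- s + _)" "indicator X _"] in
        \<open>auto simp: pint_indicator add.commute\<close>)
  also have "\<dots> \<le> ennreal (?P * (1 + G))"
    using \<delta> by (intro ennreal_leI) simp
  finally have bd: "pint UNIV (\<lambda>t. c * f (- s + t)) \<le> ennreal (?P * (1 + G))" .
  \<comment> \<open>Undoing the translation costs the factor \<open>C\<close>.\<close>
  have "pint K (\<lambda>t. c * f t) \<le> ennreal ?C * pint UNIV (\<lambda>t. c * f (- s + t))"
  proof (rule pint_transfer[where s = s])
    fix t
    have "\<omega> t \<le> C * \<omega> (s + t)" using C(3)[of "s + t"] by (simp add: algebra_simps)
    from mult_left_mono[OF this, of "cmod (c * f t)"]
    show "s + t \<in> UNIV \<and> cmod (c * f t) * \<omega> t \<le> C * (cmod (c * f (- s + (s + t))) * \<omega> (s + t))"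
      by (simp add: mult.left_commute)
  qed (use C in auto)
  also have "\<dots> \<le> ennreal ?C * ennreal (?P * (1 + G))"
    by (intro mult_left_mono bd) simp
  finally have "pint K (\<lambda>t. c * f t) \<le> ennreal (?C * (?P * (1 + G)))"
    by (simp add: ennreal_mult[symmetric] WG)
  moreover have "pint K (\<lambda>t. c * (f t - indicator K t)) \<le> ennreal (?y * \<delta>)"
  proof -
    have "pint K (\<lambda>t. c * (f t - indicator K t)) \<le> pint UNIV (\<lambda>t. c * (f t - indicator K t))"
      by (rule pint_mono) simp
    also have "\<dots> = ennreal ?y * pint UNIV (\<lambda>t. f t - indicator K t)"
      by (rule pint_cmult) measurable
    also have "\<dots> \<le> ennreal ?y * ennreal \<delta>"
      by (intro mult_left_mono f) simp
    finally show ?thesis using \<delta> by (simp add: ennreal_mult)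
  qed
  \<comment> \<open>On \<open>K\<close> the function \<open>f\<close> is nearly 1, so the bound on
    \<open>c * f\<close> becomes a bound on \<open>c\<close>.\<close>
  ultimately have "pint K (\<lambda>_. c) \<le> ennreal (?P * (?C * (?P * (1 + G)) + ?y * \<delta>))"
  proof (rule pint_triangle_real[rotated 4])
    fix t assume "t \<in> K"
    then show "cmod c \<le> cmod (c * f t) + cmod (c * (f t - indicator K t))"
      using norm_triangle_ineq4[of "c * f t" "c * (f t - 1)"] by (simp add: algebra_simps)
  qed (use WG \<delta> in auto)
  then have "?y * W \<le> ?P * (?C * (?P * (1 + G)) + ?y * \<delta>)"
  proof (subst ennreal_le_iff[symmetric])
    show "0 \<le> ?P * (?C * (?P * (1 + G)) + ?y * \<delta>)" using WG \<delta> by simp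
  qed (use WG in \<open>simp add: pint_const[OF assms(1), of c] ennreal_mult\<close>)
  \<comment> \<open>As 2^p \<delta> is at most W/2, the \<delta> term is absorbed by the left-hand
    side.\<close>
  also have "\<dots> \<le> ?y * (W / 2) + ?P * ?P * ?C * (1 + G)"
    using mult_left_mono[OF \<delta>(3), of ?y] by (simp add: algebra_simps)
  finally have "?y * W \<le> 2 * ?P * ?P * ?C * (1 + G)"
    by (simp add: algebra_simps)
  then have y: "?y \<le> 2 * ?P * ?P * ?C * (1 + G) / W"
    using WG by (simp add: field_simps)
  \<comment> \<open>For \<open>t\<close> in \<open>Z\<close> the point \<open>- s + t\<close> lies
    outside \<open>K\<close>, where \<open>f\<close> coincides with its own approximation
    error.\<close>
  have "pint Z (\<lambda>t. c * f (- s + t)) \<le> ennreal ((cmod c * C) powr p) * pint UNIV (\<lambda>t. f t - indicator K t)"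
  proof (rule pint_transfer[where s = "- s"])
    fix t assume t: "t \<in> Z"
    have "\<omega> t \<le> C * \<omega> (- s + t)" using C(2)[of "- s + t"] by (simp add: add.assoc[symmetric])
    from mult_left_mono[OF this, of "cmod (c * f (- s + t))"]
    show "- s + t \<in> UNIV \<and> cmod (c * f (- s + t)) * \<omega> t
      \<le> cmod c * C * (cmod (f (- s + t) - indicator K (- s + t)) * \<omega> (- s + t))"
      using Z(2)[OF t] by (simp add: norm_mult mult_ac)
  qed (use C in auto)
  also have "\<dots> \<le> ennreal ((cmod c * C) powr p) * ennreal \<delta>"
    by (intro mult_left_mono f) simp
  also have "\<dots> = ennreal (?y * ?C * \<delta>)"
    using \<delta> C by (simp add: ennreal_mult[symmetric] powr_mult)
  also have "\<dots> \<le> ennreal (2 * ?P * ?P * ?C * (1 + G) / W * ?C * \<delta>)"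
    using \<delta> by (intro ennreal_leI mult_right_mono y) auto
  finally have "pint Z (\<lambda>t. c * f (- s + t)) \<le> ennreal (2 * ?P * ?P * ?C * (1 + G) / W * ?C * \<delta>)" .
  moreover have "pint Z (\<lambda>t. c * f (- s + t) - indicator X t) \<le> ennreal \<delta>"
    using cf by (rule order_trans[rotated]) (rule pint_mono, simp)
  ultimately have "pint Z (\<lambda>_. 1) \<le> ennreal (?P * (2 * ?P * ?P * ?C * (1 + G) / W * ?C * \<delta> + \<delta>))"
  proof (rule pint_triangle_real[rotated 4])
    fix t assume "t \<in> Z"
    then show "cmod 1 \<le> cmod (c * f (- s + t)) + cmod (c * f (- s + t) - indicator X t)"
      using norm_triangle_ineq4[of "c * f (- s + t)" "c * f (- s + t) - 1"] Z(1) by auto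
  qed (use WG \<delta> in auto)
  then have "V \<le> ?P * (2 * ?P * ?P * ?C * (1 + G) / W * ?C * \<delta> + \<delta>)"
    using Z WG \<delta> by (simp add: ennreal_le_iff)
  \<comment> \<open>By the choice of \<delta> each of the two terms is at most V/4, which leads to V
    \<le> V/2.\<close>
  also have "\<dots> = (4 * ?P * (2 * ?P * ?P * ?C * (1 + G) / W) * ?C * \<delta>) / 4 + (4 * ?P * \<delta>) / 4"
    by (simp only: distrib_left mult.assoc) simp
  also have "\<dots> \<le> V / 4 + V / 4"
    by (intro add_mono divide_right_mono \<delta>(4,5)) simp_all
  finally show False using Z by simp
qed

text \<open>The second approximation is read in two places. On \<open>K\<close> the target is 1
  while \<open>- s + t\<close> lies off \<open>K\<close>, where \<open>f\<close> is small; so |c|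
  must be large compared with \<open>\<omega> (- s)\<close>. On \<open>s + K\<close> the target is 0
  while the translate of \<open>f\<close> is nearly 1; so |c| times \<open>\<omega> s\<close> must
  be small.\<close>

lemma close_pair_estimate:
  assumes [measurable]: "K \<in> sets borel" "X \<in> sets borel" "f \<in> borel_measurable borel"
    and f: "pint UNIV (\<lambda>t. f t - indicator K t) \<le> ennreal \<delta>"
    and cf: "pint UNIV (\<lambda>t. c * f (- s + t) - indicator X t) \<le> ennreal \<delta>"
    and W: "pint K (\<lambda>_. 1) = ennreal W" "0 < W" 
    and X: "K \<subseteq> X" "\<And>t. t \<in> K \<Longrightarrow> - s + t \<notin> K" "\<And>t. t \<in> K \<Longrightarrow> s + t \<notin> X"
    and m: "0 < m" "\<And>t s. t \<in> K \<Longrightarrow> \<omega> (t + s) \<le> m * \<omega> s" "\<And>t s. t \<in> K \<Longrightarrow> \<omega> (- t + s) \<le> m * \<omega> s"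
    and \<delta>: "0 < \<delta>" "2 * 2 powr p * \<delta> \<le> W" "2 * 2 powr p * (m\<^sup>2 * \<omega> 0) powr p * \<delta> < W * \<eta> powr p"
    and \<eta>: "0 < \<eta>"
  shows "c \<noteq> 0" "cmod c * \<omega> s < \<eta>" "\<omega> (- s) / cmod c < \<eta>"
proof -
  have [simp]: "(\<lambda>t. c * f (t - s)) \<in> borel_measurable borel"
    "(\<lambda>t. c * f (t - s) - indicator X t) \<in> borel_measurable borel"
    by measurable
  let ?P = "2 powr p"
  define D where "D = m\<^sup>2 * \<omega> 0"
  have D: "0 < D" using m weight_pos by (simp add: D_def)
  \<comment> \<open>One bound compares \<open>\<omega> t\<close> with \<open>\<omega> 0\<close>, the
    other compares \<open>\<omega> u\<close> with \<open>\<omega> (u + t)\<close>, since u = -t + (u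
    + t).\<close>
  have comp: "\<omega> t * \<omega> u \<le> D * \<omega> (u + t)" if "t \<in> K" for t u
  proof -
    have "\<omega> t * \<omega> u \<le> (m * \<omega> 0) * (m * \<omega> (u + t))"
      using m(2)[OF that, of 0] m(3)[OF that, of "u + t"] weight_pos m(1)
      by (intro mult_mono) (auto simp: less_imp_le)
    then show ?thesis by (simp add: D_def power2_eq_square mult_ac)
  qed
  \<comment> \<open>\<open>comp\<close> with \<open>u = - s\<close> bounds \<open>\<omega> t\<close>
    by \<open>D / \<omega> (- s)\<close> times \<open>\<omega> (- s + t)\<close>; \<open>b\<close>
    is that factor times |c|.\<close>
  define b where "b = cmod c * D / \<omega> (- s)"
  have b0: "0 \<le> b" using D weight_pos by (simp add: b_def less_imp_le)
  have "pint K (\<lambda>t. c * f (- s + t)) \<le> ennreal (b powr p) * pint UNIV (\<lambda>t. f t - indicator K t)"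
  proof (rule pint_transfer[where s = "- s"])
    fix t assume t: "t \<in> K"
    have "\<omega> t \<le> D / \<omega> (- s) * \<omega> (- s + t)" 
      using comp[OF t, of "- s"] weight_pos[of "- s"] by (simp add: field_simps)
    from mult_left_mono[OF this, of "cmod (c * f (- s + t))"]
    show "- s + t \<in> UNIV \<and> cmod (c * f (- s + t)) * \<omega> t
      \<le> b * (cmod (f (- s + t) - indicator K (- s + t)) * \<omega> (- s + t))"
      using X(2)[OF t] by (simp add: b_def norm_mult mult_ac)
  qed (use b0 in auto)
  also have "\<dots> \<le> ennreal (b powr p) * ennreal \<delta>"
    by (intro mult_left_mono f) simp
  finally have "pint K (\<lambda>t. c * f (- s + t)) \<le> ennreal (b powr p * \<delta>)"
    using \<delta> by (simp add: ennreal_mult)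
  moreover have "pint K (\<lambda>t. c * f (- s + t) - indicator X t) \<le> ennreal \<delta>"
    using cf by (rule order_trans[rotated]) (rule pint_mono, simp)
  ultimately have "pint K (\<lambda>_. 1) \<le> ennreal (?P * (b powr p * \<delta> + \<delta>))"
  proof (rule pint_triangle_real[rotated 4])
    fix t assume "t \<in> K"
    then show "cmod 1 \<le> cmod (c * f (- s + t)) + cmod (c * f (- s + t) - indicator X t)"
      using norm_triangle_ineq4[of "c * f (- s + t)" "c * f (- s + t) - 1"] X(1) by auto
  qed (use \<delta> in auto)
  then have "W \<le> ?P * (b powr p * \<delta> + \<delta>)"
    using W \<delta> by (simp add: ennreal_le_iff)
  \<comment> \<open>The isolated 2^p \<delta> is at most W/2 and is absorbed.\<close>
  then have Wb: "W \<le> 2 * ?P * b powr p * \<delta>"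
    using \<delta>(2) by (simp add: algebra_simps)
  then show c: "c \<noteq> 0"
    using W by (auto simp: b_def)
  \<comment> \<open>\<open>z\<close> is the quantity to be bounded; b z = D turns the lower bound on
    \<open>b\<close> into an upper bound on \<open>z\<close>.\<close>
  define z where "z = \<omega> (- s) / cmod c"
  have z: "0 < z" using c weight_pos by (simp add: z_def)
  have "b * z = D" using c weight_pos[of "- s"] by (simp add: b_def z_def)
  then have "b powr p * z powr p = D powr p"
    using b0 z by (simp flip: powr_mult)
  moreover have "z powr p * W \<le> 2 * ?P * (b powr p * z powr p) * \<delta>"
    using mult_left_mono[OF Wb, of "z powr p"] by (simp add: mult_ac)
  ultimately have "z powr p * W \<le> 2 * ?P * D powr p * \<delta>"
    by simp
  also have "\<dots> < W * \<eta> powr p" using \<delta>(3) by (simp add: D_def)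
  finally have "z powr p < \<eta> powr p" using W by (simp add: mult.commute)
  then show "\<omega> (- s) / cmod c < \<eta>"
    using z \<eta> p_pos unfolding z_def[symmetric] by (meson not_le powr_mono2 less_imp_le)
  \<comment> \<open>\<open>comp\<close> with \<open>u = s\<close> shows that x
    \<open>\<omega> t\<close> is at most |c| \<open>\<omega> (s + t)\<close> on
    \<open>K\<close>.\<close>
  define x where "x = cmod c * \<omega> s / D"
  have x: "0 < x" using c D weight_pos by (simp add: x_def)
  \<comment> \<open>The points \<open>s + t\<close> lie off \<open>X\<close>, so the values of the
    approximation there are pure error.\<close>
  have "pint K (\<lambda>t. of_real x * f t) \<le> ennreal (1 powr p) * pint UNIV (\<lambda>t. c * f (- s + t) - indicator X t)"
  proof (rule pint_transfer[where s = s])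
    fix t assume t: "t \<in> K"
    have "x * \<omega> t \<le> cmod c * \<omega> (s + t)"
      using mult_left_mono[OF comp[OF t, of s], of "cmod c"] D by (simp add: x_def field_simps)
    from mult_left_mono[OF this, of "cmod (f t)"]
    show "s + t \<in> UNIV \<and> cmod (of_real x * f t) * \<omega> t
       \<le> 1 * (cmod (c * f (- s + (s + t)) - indicator X (s + t)) * \<omega> (s + t))"
      using X(3)[OF t] x by (simp add: norm_mult mult_ac add.assoc[symmetric])
  qed auto
  also have "\<dots> \<le> ennreal \<delta>" using cf by simp
  finally have "pint K (\<lambda>t. of_real x * f t) \<le> ennreal \<delta>" .
  \<comment> \<open>As \<open>f\<close> is nearly 1 on \<open>K\<close>, smallness of
    \<open>x * f\<close> passes to the constant \<open>x\<close>; the error is again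
    absorbed.\<close>
  moreover have "pint K (\<lambda>t. of_real x * (f t - indicator K t)) \<le> ennreal (x powr p * \<delta>)"
  proof -
    have "pint K (\<lambda>t. of_real x * (f t - indicator K t)) \<le> pint UNIV (\<lambda>t. of_real x * (f t - indicator K t))"
      by (rule pint_mono) simp
    also have "\<dots> = ennreal (x powr p) * pint UNIV (\<lambda>t. f t - indicator K t)"
      using x by (subst pint_cmult) auto
    also have "\<dots> \<le> ennreal (x powr p) * ennreal \<delta>"
      by (intro mult_left_mono f) simp
    finally show ?thesis using \<delta> by (simp add: ennreal_mult)
  qed
  ultimately have "pint K (\<lambda>_. of_real x) \<le> ennreal (?P * (\<delta> + x powr p * \<delta>))"
  proof (rule pint_triangle_real[rotated 4])
    fix t assume "t \<in> K"
    then show "cmod (of_real x) \<le> cmod (of_real x * f t) + cmod (of_real x * (f t - indicator K t))"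
      using norm_triangle_ineq4[of "of_real x * f t" "of_real x * (f t - 1)"]
        by (simp add: algebra_simps)
  qed (use \<delta> in auto)
  then have "x powr p * W \<le> ?P * (\<delta> + x powr p * \<delta>)"
    using W \<delta> x
      by (simp add: pint_const[OF assms(1), of "of_real x"] ennreal_mult[symmetric] ennreal_le_iff)
  also have "\<dots> \<le> ?P * \<delta> + x powr p * (W / 2)"
    using mult_left_mono[OF \<delta>(2), of "x powr p"] by (simp add: algebra_simps)
  finally have "x powr p * W \<le> 2 * ?P * \<delta>" by (simp add: algebra_simps)
  \<comment> \<open>Multiplying by D^p replaces \<open>x\<close> by |c|
    \<open>\<omega> s\<close>.\<close>
  from mult_left_mono[OF this, of "D powr p"]
  have "(cmod c * \<omega> s) powr p * W \<le> 2 * ?P * D powr p * \<delta>"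
    using D weight_pos by (simp add: x_def powr_divide less_imp_le mult_ac)
  also have "\<dots> < W * \<eta> powr p" using \<delta>(3) by (simp add: D_def)
  finally have "(cmod c * \<omega> s) powr p < \<eta> powr p" using W by (simp add: mult.commute)
  then show "cmod c * \<omega> s < \<eta>"
    using \<eta> p_pos weight_pos[of s] by (meson not_le powr_mono2 less_imp_le)
qed

lemma dense_vector_imp_small:
  assumes "\<not> compact (UNIV :: 'g set)" "dense_vector \<mu> p \<omega> \<Gamma> S f" "0 < \<eta>"
  shows "\<exists>s\<in>S. \<exists>c\<in>\<Gamma> - {0}. cmod c * \<omega> s < \<eta> \<and> \<omega> (- s) / cmod c < \<eta>"
proof -
  have fm [measurable]: "f \<in> borel_measurable borel"
    and dense: "\<And>g \<epsilon>. g \<in> borel_measurable borel \<Longrightarrow> pint UNIV g < \<infinity> \<Longrightarrow> 0 < \<epsilon> \<Longrightarrow>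
      \<exists>c\<in>\<Gamma>. \<exists>s\<in>S. pint UNIV (\<lambda>t. c * left_translation s f t - g t) < ennreal \<epsilon>"
    using assms(2)[unfolded dense_vector_iff] by blast+
  obtain F :: "nat \<Rightarrow> 'g set" where F: "\<And>n. compact (F n)" "incseq F" "(\<Union>n. F n) = UNIV"
    "\<And>n t s. t \<in> F n \<Longrightarrow> \<omega> (t + s) \<le> real n * \<omega> s"
    "\<And>n t s. t \<in> F n \<Longrightarrow> \<omega> (- t + s) \<le> real n * \<omega> s"
    by (rule tame_exhaustion) blast
  \<comment> \<open>The sets \<open>F n\<close> cover the group, so they cannot all be null.\<close>
  obtain n where n: "emeasure \<mu> (F n) \<noteq> 0"
  proof -
    have "emeasure \<mu> (\<Union>n. F n) = 0" if "\<And>n. emeasure \<mu> (F n) = 0"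
      using that F(1) by (intro emeasure_UN_eq_0) (auto simp: borel_compact)
    then show thesis using that emeasure_UNIV_nonzero F(3) by auto
  qed
  define K and m where "K = F n" and "m = real n"
  have Kc: "compact K" and K0: "emeasure \<mu> K \<noteq> 0"
    and Km: "\<And>t s. t \<in> K \<Longrightarrow> \<omega> (t + s) \<le> m * \<omega> s" "\<And>t s. t \<in> K \<Longrightarrow> \<omega> (- t + s) \<le> m * \<omega> s"
    using F n by (auto simp: K_def m_def)
  have Kb [measurable]: "K \<in> sets borel" using Kc by (simp add: borel_compact)
  obtain k0 where "k0 \<in> K" using K0 by fastforce
  then have m: "0 < m"
    using Km(1)[of k0 0] weight_pos[of k0] weight_pos[of 0]
    by (smt (verit, best) add.right_neutral mult_nonpos_nonneg)
  \<comment> \<open>\<open>Q\<close> consists of the \<open>s\<close> for which \<open>s + K\<close>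
    meets \<open>K\<close>. Since the group is not compact, there is \<open>a\<close> outside
    \<open>Q - Q\<close>; then no \<open>s\<close> has both \<open>s\<close> and
    \<open>s - a\<close> in \<open>Q\<close>.\<close>
  define Q where "Q = {x - y | x y. x \<in> K \<and> y \<in> K}"
  have "compact {q - r | q r. q \<in> Q \<and> r \<in> Q}"
    unfolding Q_def by (intro compact_set_diff Kc)
  then have "{q - r | q r. q \<in> Q \<and> r \<in> Q} \<noteq> UNIV"
    using assms(1) by auto
  then obtain a where a: "a \<notin> {q - r | q r. q \<in> Q \<and> r \<in> Q}"
    by blast
  have Q: "x - y \<in> Q" if "x \<in> K" "y \<in> K" for x y
    using that by (auto simp: Q_def)
  have aQ: "a \<noteq> q - r" if "q \<in> Q" "r \<in> Q" for q r
    using a that by blast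
  define X where "X = K \<union> (+) a ` K"
  have X [measurable]: "X \<in> sets borel" "(+) a ` K \<in> sets borel" by (simp_all add: X_def)
  obtain W where W: "0 < W" "pint K (\<lambda>_. 1) = ennreal W"
    using pint_one_compact[OF Kc K0] by blast
  have aKc: "compact ((+) a ` K)" by (intro compact_continuous_image Kc continuous_intros)
  obtain V where V: "0 < V" "pint ((+) a ` K) (\<lambda>_. 1) = ennreal V"
    using pint_one_compact[OF aKc] emeasure_shift[OF Kb] K0 by metis
  obtain G where G: "0 < G" "pint X (\<lambda>_. 1) = ennreal G"
    using pint_one_compact[of X] Kc aKc K0 emeasure_mono[of K X \<mu>]
    unfolding X_def
      by (metis Un_upper1 X(1) X_def bot.extremum_uniqueI bot_ennreal compact_Un sets_mu)
  obtain Ca where Ca: "1 \<le> Ca" "\<And>t. \<omega> (a + t) \<le> Ca * \<omega> t" by (rule shift_bound[of a]) blast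
  obtain Cb where Cb: "1 \<le> Cb" "\<And>t. \<omega> (- a + t) \<le> Cb * \<omega> t" by (rule shift_bound[of "- a"]) blast
  \<comment> \<open>The square pays for a translation by an element of \<open>K - K\<close>, the
    maximum for one by \<open>a\<close> or \<open>- a\<close>.\<close>
  define C where "C = max Ca Cb * m\<^sup>2"
  have C: "0 < C" using Ca m by (simp add: C_def)
  have CQ: "\<omega> (q + t) \<le> m\<^sup>2 * \<omega> t" if q: "q \<in> Q" for q t
  proof -
    obtain x y where xy: "x \<in> K" "y \<in> K" "q = x - y" using q unfolding Q_def by blast
    have eq: "q + t = x + (- y + t)" using xy(3) by simp
    have "\<omega> (q + t) \<le> m * \<omega> (- y + t)" unfolding eq by (rule Km(1)[OF xy(1)])
    also have "\<dots> \<le> m * (m * \<omega> t)" using Km(2)[OF xy(2), of t] m by (intro mult_left_mono) auto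
    finally show ?thesis by (simp add: power2_eq_square mult.assoc)
  qed
  have Qm: "- q \<in> Q" if q: "q \<in> Q" for q
  proof -
    obtain x y where xy: "x \<in> K" "y \<in> K" "q = x - y" using q unfolding Q_def by blast
    show ?thesis using Q[OF xy(2,1)] xy(3) by simp
  qed
  \<comment> \<open>The three cases are those met by \<open>s\<close> and \<open>- s\<close> when
    \<open>s + K\<close> meets \<open>K\<close> or \<open>a + K\<close>.\<close>
  have CL: "\<omega> (l + t) \<le> C * \<omega> t" if l: "l \<in> Q \<or> l - a \<in> Q \<or> l + a \<in> Q" for l t
  proof -
    have M: "1 \<le> max Ca Cb" "0 < \<omega> t" using Ca weight_pos by auto
    have A: "Ca * v \<le> max Ca Cb * v" "Cb * v \<le> max Ca Cb * v" if "0 \<le> v" for v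
      using that by (auto intro: mult_right_mono)
    consider "l \<in> Q" | "l - a \<in> Q" | "l + a \<in> Q" using l by blast
    then show ?thesis
    proof cases
      case 1
      have "1 * (m\<^sup>2 * \<omega> t) \<le> max Ca Cb * (m\<^sup>2 * \<omega> t)"
        using M by (intro mult_right_mono) auto
      then show ?thesis using CQ[OF 1, of t] by (simp add: C_def mult.assoc)
    next
      case 2
      have "\<omega> (l + t) \<le> Ca * \<omega> (l - a + t)" using Ca(2)[of "l - a + t"] by (simp add: algebra_simps)
      also have "\<dots> \<le> Ca * (m\<^sup>2 * \<omega> t)" using CQ[OF 2, of t] Ca by (intro mult_left_mono) auto
      also have "\<dots> \<le> max Ca Cb * (m\<^sup>2 * \<omega> t)" using M by (intro A) auto
      finally show ?thesis by (simp add: C_def mult.assoc)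
    next
      case 3
      have "\<omega> (l + t) \<le> Cb * \<omega> (l + a + t)" using Cb(2)[of "l + a + t"] by (simp add: algebra_simps)
      also have "\<dots> \<le> Cb * (m\<^sup>2 * \<omega> t)" using CQ[OF 3, of t] Cb by (intro mult_left_mono) auto
      also have "\<dots> \<le> max Ca Cb * (m\<^sup>2 * \<omega> t)" using M by (intro A) auto
      finally show ?thesis by (simp add: C_def mult.assoc)
    qed
  qed
  \<comment> \<open>The smaller of the two sizes, so that one \<delta> serves whichever piece is
    missed.\<close>
  define w where "w = min W V"
  have w: "0 < w" "w \<le> W" "w \<le> V" using W V by (auto simp: w_def)
  define A where "A = 4 * 2 powr p * (2 * 2 powr p * 2 powr p * C powr p * (1 + G) / W) * C powr p"
  define B where "B = 2 * 2 powr p * (m\<^sup>2 * \<omega> 0) powr p"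
  have A: "0 < A" using C G W by (simp add: A_def)
  have B: "0 < B" using m weight_pos[of 0] by (simp add: B_def)
  \<comment> \<open>The second entry makes \<delta> small against both pieces, the third gives the
    contradiction in \<open>close_pair_excludes_shift\<close>, the fourth the final estimate; its
    factor 2 makes \<open>\<delta>B\<close> strict.\<close>
  define \<delta> where "\<delta> = Min {1, w / (4 * 2 powr p), w / A, W * \<eta> powr p / (2 * B)}"
  have \<delta>0: "0 < \<delta>" using w A B W assms(3) by (simp add: \<delta>_def)
  have \<delta>1: "\<delta> \<le> 1" "\<delta> \<le> w / (4 * 2 powr p)" "\<delta> \<le> w / A" "\<delta> \<le> W * \<eta> powr p / (2 * B)"
    unfolding \<delta>_def by (rule Min_le; simp)+
  have \<delta>w: "4 * 2 powr p * \<delta> \<le> w" using \<delta>1(2) by (simp add: field_simps)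
  have \<delta>A: "A * \<delta> \<le> w" using \<delta>1(3) A by (simp add: field_simps)
  have \<delta>B: "B * \<delta> < W * \<eta> powr p"
  proof -
    have "2 * (B * \<delta>) \<le> W * \<eta> powr p" using \<delta>1(4) B by (simp add: field_simps)
    moreover have "0 < B * \<delta>" using B \<delta>0 by simp
    ultimately show ?thesis by linarith
  qed
  have P1: "1 \<le> 2 powr p" using p_pos by (simp add: ge_one_powr_ge_zero)
  have PX: "2 * 2 powr p * \<delta> \<le> W" using \<delta>w w \<delta>0 by (smt (verit) mult_right_mono powr_gt_zero)
  obtain c0 s0 where c0: "pint UNIV (\<lambda>t. c0 * left_translation s0 f t - indicator K t) < ennreal \<delta>"
    using dense[of "indicator K" \<delta>] \<delta>0 W by (auto simp: pint_indicator)
  \<comment> \<open>With \<open>c0 = 0\<close> the indicator of \<open>K\<close> would itself be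
    smaller than \<delta>, although its size is W \<ge> \<delta>.\<close>
  have c0_nz: "c0 \<noteq> 0"
  proof
    assume "c0 = 0"
    then have "pint UNIV (indicator K) \<le> pint UNIV (\<lambda>t. c0 * left_translation s0 f t - indicator K t)"
      by (intro pint_mono) simp
    then have "ennreal W < ennreal \<delta>"
      using c0 W by (simp add: pint_indicator)
    then have "W < \<delta>" using W by (simp add: ennreal_less_iff)
    moreover have "\<delta> \<le> W"
    proof -
      have "\<delta> \<le> 2 powr p * \<delta>" using mult_right_mono[OF P1, of \<delta>] \<delta>0 by simp
      then show ?thesis using PX \<delta>0 by linarith
    qed
    ultimately show False by simp
  qed
  define h where "h t = c0 * left_translation s0 f t" for t
  have h [measurable]: "h \<in> borel_measurable borel" unfolding h_def by measurable
  have h_near: "pint UNIV (\<lambda>t. h t - indicator K t) \<le> ennreal \<delta>"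
    using c0 by (simp add: h_def less_imp_le)
  obtain C0 where C0: "1 \<le> C0" "\<And>t. \<omega> (s0 + t) \<le> C0 * \<omega> t" by (rule shift_bound[of s0]) blast
  \<comment> \<open>The target pulled back through \<open>c0\<close> and the translation by
    \<open>s0\<close>. Approximating \<open>g\<close> by \<open>c\<close> times the translate of
    \<open>f\<close> by \<open>s\<close> then approximates the indicator of \<open>X\<close> by the
    same \<open>c\<close> and \<open>s\<close> applied to \<open>h\<close>.\<close>
  define g where "g t = inverse c0 * left_translation (- s0) (indicator X) t" for t
  have g [measurable]: "g \<in> borel_measurable borel" unfolding g_def by measurable
  have "pint UNIV g < \<infinity>"
    unfolding g_def using G by (intro pint_translation_finite) (auto simp: pint_indicator)
  \<comment> \<open>Going forward again through \<open>c0\<close> and \<open>s0\<close> multiplies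
    \<open>pint\<close> by at most this denominator.\<close>
  moreover define \<delta>' where "\<delta>' = \<delta> / ((cmod c0 * C0) powr p)"
  moreover have c0C0: "0 < (cmod c0 * C0) powr p" using c0_nz C0 by simp
  ultimately obtain c s where cs: "c \<in> \<Gamma>" "s \<in> S"
    "pint UNIV (\<lambda>t. c * left_translation s f t - g t) < ennreal \<delta>'"
    using dense[OF g, of \<delta>'] \<delta>0 by auto
  let ?d = "\<lambda>t. c * left_translation s f t - g t"
  have "pint UNIV (\<lambda>t. c * h (- s + t) - indicator X t) \<le> ennreal ((cmod c0 * C0) powr p) * pint UNIV ?d"
  proof (rule pint_transfer[where s = "- s0"])
    fix t
    \<comment> \<open>This is where the translations by \<open>s\<close> and \<open>s0\<close> have
      to commute.\<close>
    have eq: "c * h (- s + t) - indicator X t = c0 * ?d (- s0 + t)"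
      using c0_nz by (simp add: h_def g_def left_translation_def algebra_simps)
    have "\<omega> t \<le> C0 * \<omega> (- s0 + t)" using C0(2)[of "- s0 + t"] by (simp add: add.assoc[symmetric])
    from mult_left_mono[OF this, of "cmod (c0 * ?d (- s0 + t))"]
    show "- s0 + t \<in> UNIV \<and> cmod (c * h (- s + t) - indicator X t) * \<omega> t
       \<le> cmod c0 * C0 * (cmod (?d (- s0 + t)) * \<omega> (- s0 + t))"
      unfolding eq by (simp add: norm_mult mult_ac)
  qed (use C0 in auto)
  also have "\<dots> \<le> ennreal ((cmod c0 * C0) powr p) * ennreal \<delta>'"
    using cs(3) by (intro mult_left_mono) (auto intro: less_imp_le)
  also have "\<dots> = ennreal \<delta>"
    using c0C0 \<delta>0 by (simp add: \<delta>'_def ennreal_mult[symmetric])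
  finally have ch_near: "pint UNIV (\<lambda>t. c * h (- s + t) - indicator X t) \<le> ennreal \<delta>" .
  have excl: False if Z: "Z \<in> sets borel" "Z \<subseteq> X" "\<And>t. t \<in> Z \<Longrightarrow> - s + t \<notin> K"
    "pint Z (\<lambda>_. 1) = ennreal V'" "w \<le> V'" and s: "s \<in> Q \<or> s - a \<in> Q" for Z V'
  proof (rule close_pair_excludes_shift[OF Kb X(1) Z(1) h h_near ch_near W(2,1) eq_refl[OF G(2)] _ Z(2-4)])
    have "- s \<in> Q \<or> - s + a \<in> Q" using s Qm by (metis minus_diff_eq uminus_add_conv_diff)
    then show "\<omega> (- s + t) \<le> C * \<omega> t" "\<omega> (s + t) \<le> C * \<omega> t" for t
      using CL[of "- s" t] CL[of s t] s by blast+
    show "4 * 2 powr p * (2 * 2 powr p * 2 powr p * C powr p * (1 + G) / W) * C powr p * \<delta> \<le> V'"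
      using \<delta>A Z(5) by (simp add: A_def)
  qed (use C G w Z(5) \<delta>0 \<delta>1 \<delta>w PX in auto)
  have s1: "s \<notin> Q"
  proof
    assume s: "s \<in> Q"
    \<comment> \<open>A common point of \<open>s + K\<close> and \<open>a + K\<close> would put
      \<open>a\<close> into \<open>Q - Q\<close>.\<close>
    have "- s + t \<notin> K" if "t \<in> (+) a ` K" for t
    proof
      assume k: "- s + t \<in> K"
      obtain u where u: "u \<in> K" "t = a + u" using \<open>t \<in> (+) a ` K\<close> by blast
      have "a = (- s + t - u) - (- s)" using u by simp
      then show False using aQ[OF Q[OF k u(1)] Qm[OF s]] by simp
    qed
    then show False using excl[of "(+) a ` K" V] V w s X by (auto simp: X_def)
  qed
  have s2: "s - a \<notin> Q"
  proof
    assume s: "s - a \<in> Q"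
    \<comment> \<open>A common point of \<open>s + K\<close> and \<open>K\<close> would likewise put
      \<open>a\<close> into \<open>Q - Q\<close>.\<close>
    have "- s + t \<notin> K" if t: "t \<in> K" for t
    proof
      assume k: "- s + t \<in> K"
      have "a = (t - (- s + t)) - (s - a)" by simp
      then show False using aQ[OF Q[OF t k] s] by simp
    qed
    then show False using excl[of K W] W w s by (auto simp: X_def)
  qed
  have KX: "K \<subseteq> X" by (auto simp: X_def)
  \<comment> \<open>Since \<open>s\<close> and \<open>s - a\<close> avoid \<open>Q\<close>, the set
    \<open>s + K\<close> is disjoint from both pieces.\<close>
  have n1: "- s + t \<notin> K" if t: "t \<in> K" for t
    using Q[OF t, of "- s + t"] s1 by auto
  have n2: "s + t \<notin> X" if t: "t \<in> K" for t
  proof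
    assume "s + t \<in> X"
    then consider "s + t \<in> K" | u where "u \<in> K" "s + t = a + u" by (auto simp: X_def)
    then show False
    proof cases
      case 1
      then show False using Q[OF 1 t] s1 by simp
    next
      case 2
      then have "s - a = u - t" by (simp add: algebra_simps)
      then show False using Q[OF 2(1) t] s2 by simp
    qed
  qed
  note close_pair_estimate[OF Kb X(1) h h_near ch_near W(2,1) KX n1 n2 m Km \<delta>0 PX
      \<delta>B[unfolded B_def] assms(3)]
  then show ?thesis using cs by blast
qed


section \<open>Approximation by countably many tame functions\<close>

text \<open>In general translation by \<open>s\<close> costs a power of M(s). Here it costs a power
  of \<open>\<omega> s\<close>, the quantity that the limit hypothesis controls.\<close>

definition tame :: "('g \<Rightarrow> complex) \<Rightarrow> bool" where
  "tame h \<longleftrightarrow> h \<in> borel_measurable borel \<and>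
    (\<exists>C\<ge>0. \<forall>s. pint UNIV (left_translation s h) \<le> ennreal (C * \<omega> s powr p))"

lemma tameE:
  assumes "tame h"
  obtains C where "0 \<le> C" "\<And>s. pint UNIV (left_translation s h) \<le> ennreal (C * \<omega> s powr p)"
  using assms unfolding tame_def by blast

lemma tame_measurable: "tame h \<Longrightarrow> h \<in> borel_measurable borel"
  by (simp add: tame_def)

lemma tame_add:
  assumes "tame f" "tame g"
  shows "tame (\<lambda>t. f t + g t)"
proof -
  note [measurable] = assms[THEN tame_measurable]
  obtain A where A: "0 \<le> A" "\<And>s. pint UNIV (left_translation s f) \<le> ennreal (A * \<omega> s powr p)"
    using tameE[OF assms(1)] by blast
  obtain B where B: "0 \<le> B" "\<And>s. pint UNIV (left_translation s g) \<le> ennreal (B * \<omega> s powr p)"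
    using tameE[OF assms(2)] by blast
  have "pint UNIV (left_translation s (\<lambda>t. f t + g t)) \<le> ennreal (2 powr p * (A + B) * \<omega> s powr p)" for s
  proof -
    have "pint UNIV (left_translation s (\<lambda>t. f t + g t))
        \<le> ennreal (2 powr p * (A * \<omega> s powr p + B * \<omega> s powr p))"
      using A(1) B(1) assms[THEN tame_measurable]
      by (intro pint_triangle_real[OF left_translation_measurable left_translation_measurable _ _ A(2) B(2)])
        (auto simp: left_translation_def norm_triangle_ineq)
    then show ?thesis by (simp add: algebra_simps)
  qed
  then show ?thesis using A(1) B(1)
    by (auto simp: tame_def intro!: exI[of _ "2 powr p * (A + B)"])
qed

lemma tame_cmult:
  assumes "tame f"
  shows "tame (\<lambda>t. c * f t)"
proof -
  note [measurable] = assms[THEN tame_measurable]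
  obtain A where A: "0 \<le> A" "\<And>s. pint UNIV (left_translation s f) \<le> ennreal (A * \<omega> s powr p)"
    using tameE[OF assms] by blast
  have "pint UNIV (left_translation s (\<lambda>t. c * f t)) \<le> ennreal (cmod c powr p * A * \<omega> s powr p)" for s
  proof -
    have "left_translation s (\<lambda>t. c * f t) = (\<lambda>t. c * left_translation s f t)"
      by (simp add: left_translation_def)
    then have "pint UNIV (left_translation s (\<lambda>t. c * f t)) = ennreal (cmod c powr p) * pint UNIV (left_translation s f)"
      by (simp add: pint_cmult left_translation_measurable)
    also have "\<dots> \<le> ennreal (cmod c powr p) * ennreal (A * \<omega> s powr p)"
      by (intro mult_left_mono A) simp
    also have "\<dots> = ennreal (cmod c powr p * A * \<omega> s powr p)"
      using A(1) by (simp add: ennreal_mult mult.assoc)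
    finally show ?thesis .
  qed
  then show ?thesis using A(1)
    by (auto simp: tame_def intro!: exI[of _ "cmod c powr p * A"])
qed

text \<open>Translations compose, and \<open>\<omega> (u + s)\<close> is at most a constant times
  \<open>\<omega> s\<close>. Needed because the summands of the dense vector are translates.\<close>

lemma tame_translation:
  assumes "tame f"
  shows "tame (left_translation u f)"
proof -
  note [measurable] = assms[THEN tame_measurable]
  obtain A where A: "0 \<le> A" "\<And>s. pint UNIV (left_translation s f) \<le> ennreal (A * \<omega> s powr p)"
    using tameE[OF assms] by blast
  obtain C where C: "1 \<le> C" "\<And>t. \<omega> (u + t) \<le> C * \<omega> t" by (rule shift_bound[of u]) blast
  have "pint UNIV (left_translation s (left_translation u f)) \<le> ennreal (A * C powr p * \<omega> s powr p)" for s
  proof -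
    have "left_translation s (left_translation u f) = left_translation (u + s) f"
      by (simp add: left_translation_def fun_eq_iff algebra_simps)
    then have "pint UNIV (left_translation s (left_translation u f)) \<le> ennreal (A * \<omega> (u + s) powr p)"
      using A(2) by simp
    also have "\<dots> \<le> ennreal (A * (C * \<omega> s) powr p)"
      using A(1) C(2)[of s] p_pos weight_pos[of "u + s"]
      by (intro ennreal_leI mult_left_mono powr_mono2) auto
    finally show ?thesis using C weight_pos[of s] by (simp add: powr_mult mult.assoc)
  qed
  then show ?thesis using A(1)
    by (auto simp: tame_def intro!: exI[of _ "A * C powr p"])
qed

text \<open>When \<open>- s + t\<close> lies in \<open>K\<close>, \<open>\<omega> t\<close> is at
  most m \<open>\<omega> s\<close> and \<open>\<omega> 0\<close> is at most m
  \<open>\<omega> (- s + t)\<close>. Multiplying the two gives the factor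
  \<open>D * \<omega> s\<close>.\<close>

lemma tame_indicator:
  assumes [measurable]: "A \<in> sets borel" and "A \<subseteq> K" "compact K"
    and m: "0 \<le> m" "\<And>t s. t \<in> K \<Longrightarrow> \<omega> (t + s) \<le> m * \<omega> s" "\<And>t s. t \<in> K \<Longrightarrow> \<omega> (- t + s) \<le> m * \<omega> s"
  shows "tame (indicator A)"
proof -
  have "pint UNIV (indicator A :: 'g \<Rightarrow> complex) \<le> pint K (\<lambda>_. 1)"
    unfolding pint_def using assms(2) p_pos
    by (intro nn_integral_mono) (auto split: split_indicator)
  also have "\<dots> < \<infinity>"
    using wt assms(3) weight_pos by (simp add: weight_def pint_def)
  finally obtain B where B: "0 \<le> B" "pint UNIV (indicator A :: 'g \<Rightarrow> complex) = ennreal B"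
    by (cases "pint UNIV (indicator A :: 'g \<Rightarrow> complex)") auto
  define D where "D = m\<^sup>2 / \<omega> 0"
  have D: "0 \<le> D" using weight_pos[of 0] by (simp add: D_def)
  have "pint UNIV (left_translation s (indicator A)) \<le> ennreal (D powr p * B * \<omega> s powr p)" for s
  proof -
    have "pint UNIV (left_translation s (indicator A)) \<le> ennreal ((D * \<omega> s) powr p) * pint UNIV (indicator A :: 'g \<Rightarrow> complex)"
    proof (rule pint_transfer[where s = "- s"])
      fix t
      have "\<omega> t \<le> D * \<omega> s * \<omega> (- s + t)" if u: "- s + t \<in> K"
      proof -
        have "\<omega> 0 \<le> m * \<omega> (- s + t)" using m(3)[OF u, of "- s + t"] by simp
        moreover have "\<omega> t \<le> m * \<omega> s" using m(2)[OF u, of s] by simp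
        ultimately have "\<omega> t * \<omega> 0 \<le> (m * \<omega> s) * (m * \<omega> (- s + t))"
          using m(1) weight_pos[of 0] weight_pos[of s] by (intro mult_mono) auto
        then show ?thesis using weight_pos[of 0] by (simp add: D_def field_simps power2_eq_square)
      qed
      then show "- s + t \<in> UNIV \<and> cmod (left_translation s (indicator A) t) * \<omega> t
          \<le> D * \<omega> s * (cmod (indicator A (- s + t)) * \<omega> (- s + t))"
        using assms(2) by (auto simp: left_translation_def split: split_indicator)
    qed (use D weight_pos[of s] in auto)
    then show ?thesis
      using D B weight_pos[of s] by (simp add: powr_mult ennreal_mult[symmetric] mult_ac)
  qed
  then show ?thesis using B D
    by (auto simp: tame_def intro!: exI[of _ "D powr p * B"])
qed

lemma tame_sum_list:
  assumes "\<And>x. x \<in> set xs \<Longrightarrow> tame (F x)"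
  shows "tame (\<lambda>t. \<Sum>x\<leftarrow>xs. F x t)"
  using assms
proof (induction xs)
  case Nil
  have "pint UNIV (left_translation s (\<lambda>t. 0)) \<le> ennreal (0 * \<omega> s powr p)" for s
    using p_pos by (simp add: pint_def left_translation_def)
  then show ?case by (auto simp: tame_def)
next
  case (Cons x xs)
  then show ?case by (simp add: tame_add)
qed

lemma tame_pint_finite:
  assumes "tame h"
  shows "pint UNIV h < \<infinity>"
proof -
  obtain A where A: "0 \<le> A" "\<And>s. pint UNIV (left_translation s h) \<le> ennreal (A * \<omega> s powr p)"
    using tameE[OF assms] by blast
  have "pint UNIV h \<le> ennreal (A * \<omega> 0 powr p)"
    using A(2)[of 0] by (simp add: left_translation_def)
  then show ?thesis by (auto intro: le_less_trans)
qed

section \<open>Closure in the seminorm, and approximation of functions and of sets\<close>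

definition pclosure :: "('g \<Rightarrow> complex) set \<Rightarrow> ('g \<Rightarrow> complex) set" where
  "pclosure D = {f \<in> borel_measurable borel. \<forall>\<epsilon>>0. \<exists>h\<in>D. pint UNIV (\<lambda>t. h t - f t) < ennreal \<epsilon>}"

text \<open>After the factor 2^p of the triangle inequality the two errors add up to \<epsilon>/2,
  which leaves room for strictness.\<close>

lemma pint_triangle_less:
  assumes "f \<in> borel_measurable borel" "g \<in> borel_measurable borel"
    and "\<And>t. cmod (h t) \<le> cmod (f t) + cmod (g t)" "0 < \<epsilon>"
    and "pint UNIV f < ennreal (\<epsilon> / (4 * 2 powr p))" "pint UNIV g < ennreal (\<epsilon> / (4 * 2 powr p))"
  shows "pint UNIV h < ennreal \<epsilon>"
proof -
  have "pint UNIV h \<le> ennreal (2 powr p * (\<epsilon> / (4 * 2 powr p) + \<epsilon> / (4 * 2 powr p)))"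
    using assms(4)
      by (intro pint_triangle_real[OF assms(1,2) _ assms(3)] less_imp_le[OF assms(5)] less_imp_le[OF assms(6)]) auto
  also have "\<dots> < ennreal \<epsilon>" using assms(4) by (intro ennreal_lessI) (auto simp: field_simps)
  finally show ?thesis .
qed

lemma pclosure_closed:
  assumes D: "D \<subseteq> borel_measurable borel" and [measurable]: "f \<in> borel_measurable borel"
    and f: "\<And>\<epsilon>. 0 < \<epsilon> \<Longrightarrow> \<exists>g\<in>pclosure D. pint UNIV (\<lambda>t. g t - f t) < ennreal \<epsilon>"
  shows "f \<in> pclosure D"
proof -
  have "\<exists>h\<in>D. pint UNIV (\<lambda>t. h t - f t) < ennreal \<epsilon>" if \<epsilon>: "0 < \<epsilon>" for \<epsilon>
  proof -
    have \<epsilon>': "0 < \<epsilon> / (4 * 2 powr p)" using \<epsilon> by simp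
    obtain g where g: "g \<in> pclosure D" "pint UNIV (\<lambda>t. g t - f t) < ennreal (\<epsilon> / (4 * 2 powr p))"
      using f[OF \<epsilon>'] by blast
    then obtain h where h: "h \<in> D" "pint UNIV (\<lambda>t. h t - g t) < ennreal (\<epsilon> / (4 * 2 powr p))"
      using \<epsilon>' unfolding pclosure_def by blast
    have [measurable]: "h \<in> borel_measurable borel" "g \<in> borel_measurable borel"
      using h(1) D g(1) by (auto simp: pclosure_def)
    have "pint UNIV (\<lambda>t. h t - f t) < ennreal \<epsilon>"
    proof (rule pint_triangle_less[OF _ _ _ \<epsilon> h(2) g(2)])
      fix t show "cmod (h t - f t) \<le> cmod (h t - g t) + cmod (g t - f t)"
        using norm_triangle_ineq[of "h t - g t" "g t - f t"] by simp
    qed measurable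
    then show ?thesis using h(1) by blast
  qed
  then show ?thesis by (simp add: pclosure_def)
qed

lemma pclosure_add:
  assumes D: "D \<subseteq> borel_measurable borel" "\<And>g h. g \<in> D \<Longrightarrow> h \<in> D \<Longrightarrow> (\<lambda>t. g t + h t) \<in> D"
    and f: "f \<in> pclosure D" "f' \<in> pclosure D"
  shows "(\<lambda>t. f t + f' t) \<in> pclosure D"
proof -
  have [measurable]: "f \<in> borel_measurable borel" "f' \<in> borel_measurable borel"
    using f by (auto simp: pclosure_def)
  have "\<exists>h\<in>D. pint UNIV (\<lambda>t. h t - (f t + f' t)) < ennreal \<epsilon>" if \<epsilon>: "0 < \<epsilon>" for \<epsilon>
  proof -
    have \<epsilon>': "0 < \<epsilon> / (4 * 2 powr p)" using \<epsilon> by simp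
    obtain g where g: "g \<in> D" "pint UNIV (\<lambda>t. g t - f t) < ennreal (\<epsilon> / (4 * 2 powr p))"
      using f(1) \<epsilon>' unfolding pclosure_def by blast
    obtain g' where g': "g' \<in> D" "pint UNIV (\<lambda>t. g' t - f' t) < ennreal (\<epsilon> / (4 * 2 powr p))"
      using f(2) \<epsilon>' unfolding pclosure_def by blast
    have [measurable]: "g \<in> borel_measurable borel" "g' \<in> borel_measurable borel"
      using g(1) g'(1) D by auto
    have "pint UNIV (\<lambda>t. (g t + g' t) - (f t + f' t)) < ennreal \<epsilon>"
    proof (rule pint_triangle_less[OF _ _ _ \<epsilon> g(2) g'(2)])
      fix t show "cmod ((g t + g' t) - (f t + f' t)) \<le> cmod (g t - f t) + cmod (g' t - f' t)"
        using norm_triangle_ineq[of "g t - f t" "g' t - f' t"] by (simp add: algebra_simps)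
    qed measurable
    then show ?thesis by (rule bexI[OF _ D(2)[OF g(1) g'(1)]])
  qed
  then show ?thesis by (simp add: pclosure_def)
qed

lemma pclosure_subset:
  assumes "D \<subseteq> borel_measurable borel"
  shows "D \<subseteq> pclosure D"
proof
  fix h assume "h \<in> D"
  moreover have "pint UNIV (\<lambda>t. h t - h t) = 0" using p_pos by (simp add: pint_def)
  ultimately show "h \<in> pclosure D"
    using assms unfolding pclosure_def by (auto intro!: bexI[of _ h])
qed

lemma pclosure_sum:
  assumes D: "D \<subseteq> borel_measurable borel" "\<And>g h. g \<in> D \<Longrightarrow> h \<in> D \<Longrightarrow> (\<lambda>t. g t + h t) \<in> D"
    "(\<lambda>t. 0) \<in> D"
    and "finite I" "\<And>i. i \<in> I \<Longrightarrow> f i \<in> pclosure D"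
  shows "(\<lambda>t. \<Sum>i\<in>I. f i t) \<in> pclosure D"
  using assms(4,5)
proof (induction I)
  case empty
  then show ?case using pclosure_subset[OF D(1)] D(3) by auto
next
  case (insert i I)
  then have "(\<lambda>t. f i t + (\<Sum>i\<in>I. f i t)) \<in> pclosure D"
    by (intro pclosure_add[OF D(1,2)]) auto
  with insert show ?case by simp
qed

text \<open>The difference \<open>u i - f\<close> is bounded pointwise by \<open>3 * f\<close>, so
  dominated convergence applies.\<close>

lemma pint_dominated:
  assumes [measurable]: "\<And>i. u i \<in> borel_measurable borel" "f \<in> borel_measurable borel"
    and lim: "\<And>t. (\<lambda>i. u i t) \<longlonglongrightarrow> f t" and bd: "\<And>i t. cmod (u i t) \<le> 2 * cmod (f t)"
    and fin: "pint UNIV f < \<infinity>"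
  shows "(\<lambda>i. pint UNIV (\<lambda>t. u i t - f t)) \<longlonglongrightarrow> 0"
proof -
  let ?i = "\<lambda>f t. ennreal ((cmod (f t) * \<omega> t) powr p) * indicator UNIV t"
  have "(\<lambda>i. \<integral>\<^sup>+t. ?i (\<lambda>t. u i t - f t) t \<partial>\<mu>) \<longlonglongrightarrow> (\<integral>\<^sup>+t. 0 \<partial>\<mu>)"
  proof (rule nn_integral_dominated_convergence[where w = "?i (\<lambda>t. 3 * f t)"])
    show "AE t in \<mu>. ?i (\<lambda>t. u i t - f t) t \<le> ?i (\<lambda>t. 3 * f t) t" for i
    proof (intro AE_I2)
      fix t
      have "cmod (u i t - f t) \<le> cmod (3 * f t)"
        using norm_triangle_ineq4[of "u i t" "f t"] bd[of i t] by (simp add: norm_mult)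
      then show "?i (\<lambda>t. u i t - f t) t \<le> ?i (\<lambda>t. 3 * f t) t"
        using weight_pos[of t] p_pos
        by (simp add: ennreal_leI powr_mono2 mult_right_mono less_imp_le)
    qed
    show "(\<integral>\<^sup>+t. ?i (\<lambda>t. 3 * f t) t \<partial>\<mu>) < \<infinity>"
    proof -
      have "pint UNIV (\<lambda>t. 3 * f t) < \<infinity>" using fin by (simp add: pint_cmult ennreal_mult_less_top)
      then show ?thesis by (simp only: pint_def)
    qed
    show "AE t in \<mu>. (\<lambda>i. ?i (\<lambda>t. u i t - f t) t) \<longlonglongrightarrow> 0"
    proof (intro AE_I2)
      fix t
      have "(\<lambda>i. cmod (u i t - f t) * \<omega> t) \<longlonglongrightarrow> 0 * \<omega> t"
        using lim[of t]
          by (intro tendsto_mult tendsto_const) (simp add: LIM_zero_iff tendsto_norm_zero)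
      then have "(\<lambda>i. (cmod (u i t - f t) * \<omega> t) powr p) \<longlonglongrightarrow> (0 * \<omega> t) powr p"
        using p_pos weight_pos[of t] by (intro tendsto_powr' tendsto_const) auto
      then have "(\<lambda>i. ennreal ((cmod (u i t - f t) * \<omega> t) powr p)) \<longlonglongrightarrow> ennreal 0"
        by (intro tendsto_ennrealI) (simp add: p_pos)
      then show "(\<lambda>i. ?i (\<lambda>t. u i t - f t) t) \<longlonglongrightarrow> 0" by simp
    qed
  qed measurable
  then show ?thesis by (simp add: pint_def)
qed

text \<open>Outer regularity gives an open \<open>U\<close> just larger than \<open>A\<close>. It is
  a countable union of basic sets, and since \<open>U\<close> has finite measure, finitely many of
  them fill it up to small measure.\<close>

lemma finite_union_approximation:
  assumes B: "topological_basis B" and A [measurable]: "A \<in> sets borel" and fin: "emeasure \<mu> A < \<infinity>" and \<epsilon>: "0 < \<epsilon>"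
  obtains \<V> where "finite \<V>" "\<V> \<subseteq> B" "emeasure \<mu> ((\<Union>\<V> - A) \<union> (A - \<Union>\<V>)) < ennreal \<epsilon>"
proof -
  have "emeasure \<mu> A < emeasure \<mu> A + ennreal (\<epsilon> / 2)"
    using ennreal_add_left_cancel_less[of "emeasure \<mu> A" 0 "ennreal (\<epsilon> / 2)"] fin \<epsilon> by simp
  then have "(INF U\<in>{U. open U \<and> A \<subseteq> U}. emeasure \<mu> U) < emeasure \<mu> A + ennreal (\<epsilon> / 2)"
    by (simp only: emeasure_outer[OF A, symmetric])
  then obtain U where U: "open U" "A \<subseteq> U" "emeasure \<mu> U < emeasure \<mu> A + ennreal (\<epsilon> / 2)"
    unfolding INF_less_iff by blast
  have [measurable]: "U \<in> sets borel" using U by simp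
  have Ufin: "emeasure \<mu> U < \<infinity>"
  proof -
    have "emeasure \<mu> A + ennreal (\<epsilon> / 2) < \<infinity>" using fin by simp
    with U(3) show ?thesis by (rule order.strict_trans)
  qed
  have "emeasure \<mu> A + emeasure \<mu> (U - A) = emeasure \<mu> U"
    using U(2) by (subst plus_emeasure) (auto intro!: arg_cong[where f = "emeasure \<mu>"])
  then have 1: "emeasure \<mu> (U - A) < ennreal (\<epsilon> / 2)"
    using U(3) fin by (metis ennreal_add_left_cancel_less)
  obtain B' where B': "B' \<subseteq> B" "\<Union>B' = U" using B U(1) by (meson topological_basis_def)
  obtain C where C: "C \<subseteq> B'" "countable C" "\<Union>C = \<Union>B'"
    by (rule Lindelof[of B']) (use B B' topological_basis_open in blast)+
  show thesis
  \<comment> \<open>\<open>from_nat_into\<close> enumerates only nonempty sets.\<close>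
  proof (cases "C = {}")
    case True
    then have "U = {}" using B' C by auto
    then show ?thesis using U(2) \<epsilon> by (intro that[of "{}"]) auto
  next
    case False
    define V where "V m = (\<Union>i<m. from_nat_into C i)" for m
    have CB: "from_nat_into C i \<in> B" for i
      using from_nat_into[OF False, of i] C(1) B'(1) by blast
    have [measurable]: "V m \<in> sets borel" for m
      unfolding V_def using CB topological_basis_open[OF B] by (intro borel_open open_UN) auto
    have "(\<lambda>m. emeasure \<mu> (U - V m)) \<longlonglongrightarrow> emeasure \<mu> (\<Inter>m. U - V m)"
    proof (rule Lim_emeasure_decseq)
      show "decseq (\<lambda>m. U - V m)" by (intro decseq_SucI) (auto simp: V_def less_Suc_eq)
      show "emeasure \<mu> (U - V m) \<noteq> \<infinity>" for m
        using Ufin emeasure_mono[of "U - V m" U \<mu>] by (auto simp: top_unique)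
    qed auto
    moreover have "(\<Inter>m. U - V m) = {}"
    proof -
      have "x \<in> (\<Union>m. V m)" if x: "x \<in> U" for x
      proof -
        obtain c where c: "c \<in> C" "x \<in> c" using x B'(2) C(3) by blast
        obtain i where "from_nat_into C i = c" using from_nat_into_surj[OF C(2) c(1)] by blast
        then have "x \<in> V (Suc i)" using c by (auto simp: V_def)
        then show ?thesis by blast
      qed
      then show ?thesis by blast
    qed
    ultimately have "(\<lambda>m. emeasure \<mu> (U - V m)) \<longlonglongrightarrow> 0"
      by (simp only: emeasure_empty)
    then have "\<forall>\<^sub>F m in sequentially. emeasure \<mu> (U - V m) < ennreal (\<epsilon> / 2)"
      using \<epsilon> by (intro order_tendstoD) auto
    then obtain m where m: "emeasure \<mu> (U - V m) < ennreal (\<epsilon> / 2)"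
      by (auto simp: eventually_sequentially)
    have VU: "V m \<subseteq> U"
      unfolding V_def using from_nat_into[OF False] C(3) B'(2) by blast
    have "emeasure \<mu> ((V m - A) \<union> (A - V m)) \<le> emeasure \<mu> ((U - A) \<union> (U - V m))"
      using VU U(2) by (intro emeasure_mono) auto
    also have "\<dots> \<le> emeasure \<mu> (U - A) + emeasure \<mu> (U - V m)"
      by (intro emeasure_subadditive) auto
    also have "\<dots> < ennreal (\<epsilon> / 2) + ennreal (\<epsilon> / 2)"
      by (intro add_strict_mono 1 m)
    also have "\<dots> = ennreal \<epsilon>" using \<epsilon> by (simp flip: ennreal_plus)
    finally have "emeasure \<mu> ((V m - A) \<union> (A - V m)) < ennreal \<epsilon>" .
    moreover have "V m = \<Union>(from_nat_into C ` {..<m})" by (simp add: V_def)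
    ultimately show ?thesis using CB by (intro that[of "from_nat_into C ` {..<m}"]) auto
  qed
qed

end

section \<open>Diagonal selection and weighted series\<close>

lemma diagonal_choice:
  fixes Q :: "nat \<Rightarrow> nat \<Rightarrow> nat \<Rightarrow> nat \<Rightarrow> bool"
  assumes "\<And>j k m. \<forall>\<^sub>F n in sequentially. Q j k m n"
  obtains r where "\<And>j k. j < k \<Longrightarrow> Q j k (r j) (r k)"
proof -
  obtain N where N: "\<And>j k m n. N j k m \<le> n \<Longrightarrow> Q j k m n"
    using assms unfolding eventually_sequentially by metis
  \<comment> \<open>The recursion remembers only \<open>r k\<close>, so the thresholds of all
    \<open>m\<close> up to \<open>r k\<close> are met. As \<open>r\<close> is monotone, these
    include every earlier \<open>r j\<close>.\<close>
  have "\<exists>r. \<forall>k. True \<and> (r k \<le> r (Suc k) \<and> (\<forall>j\<le>k. \<forall>m\<le>r k. N j (Suc k) m \<le> r (Suc k)))"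
  proof (rule dependent_nat_choice)
    fix x k :: nat
    let ?y = "x + (\<Sum>j\<le>k. \<Sum>m\<le>x. N j (Suc k) m)"
    have "N j (Suc k) m \<le> ?y" if "j \<le> k" "m \<le> x" for j m
    proof -
      have "N j (Suc k) m \<le> (\<Sum>m\<le>x. N j (Suc k) m)"
        using that by (intro member_le_sum) auto
      also have "\<dots> \<le> (\<Sum>j\<le>k. \<Sum>m\<le>x. N j (Suc k) m)"
        using that by (intro member_le_sum[where f = "\<lambda>j. \<Sum>m\<le>x. N j (Suc k) m"]) auto
      finally show ?thesis by simp
    qed
    then show "\<exists>y. True \<and> (x \<le> y \<and> (\<forall>j\<le>k. \<forall>m\<le>x. N j (Suc k) m \<le> y))"
      by (intro exI[of _ ?y]) auto
  qed simp
  then obtain r where r: "\<And>k. r k \<le> r (Suc k)" "\<And>k j m. j \<le> k \<Longrightarrow> m \<le> r k \<Longrightarrow> N j (Suc k) m \<le> r (Suc k)"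
    by blast
  show thesis
  proof
    fix j k :: nat assume "j < k"
    then obtain l where l: "k = Suc l" "j \<le> l" by (cases k) auto
    have "r j \<le> r l" using lift_Suc_mono_le[of r j l] r(1) l(2) by simp
    then show "Q j k (r j) (r k)" using N r(2)[OF l(2)] l(1) by simp
  qed
qed

text \<open>The weights \<open>2\<^sup>k\<close> replace the triangle inequality for countably many summands: they make
  every single term of the right-hand side bound the whole series.\<close>

lemma summable_of_weighted_powr:
  fixes b :: "nat \<Rightarrow> complex"
  assumes "0 < p" "0 < w"
    and fin: "(\<Sum>k. ennreal ((2 * 2 ^ k * cmod (b k) * w) powr p)) < \<infinity>"
  shows "summable b" (is ?S)
    and "ennreal ((cmod (\<Sum>k. b k) * w) powr p) \<le> (\<Sum>k. ennreal ((2 * 2 ^ k * cmod (b k) * w) powr p))"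
      (is "?L \<le> ?R")
proof -
  obtain T where T: "?R = ennreal T" "0 \<le> T"
  proof (cases ?R rule: ennreal_cases)
    case top
    then show ?thesis using fin by (simp only: infinity_ennreal_def less_irrefl)
  qed blast
  define r where "r = T powr (1 / p)"
  have bd: "cmod (b k) \<le> r / w * (1 / 2) ^ Suc k" for k
  proof -
    have "h k \<le> suminf h" for h :: "nat \<Rightarrow> ennreal"
      using sum_le_suminf[of h "{k}"] by simp
    from this[of "\<lambda>k. ennreal ((2 * 2 ^ k * cmod (b k) * w) powr p)"]
    have "(2 * 2 ^ k * cmod (b k) * w) powr p \<le> T"
      unfolding T(1) by (simp only: ennreal_le_iff[OF T(2)])
    then have "((2 * 2 ^ k * cmod (b k) * w) powr p) powr (1 / p) \<le> T powr (1 / p)"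
      using assms(1) by (intro powr_mono2) auto
    then have "2 * 2 ^ k * cmod (b k) * w \<le> r"
      using assms(1,2) by (simp add: powr_powr r_def)
    then show ?thesis using assms(2) by (simp add: field_simps)
  qed
  \<comment> \<open>The leading factor 2 of the weights makes the geometric series sum to exactly 1,
    so the bound is \<open>r / w\<close> without further constant.\<close>
  have sg: "(\<lambda>k. r / w * (1 / 2) ^ Suc k) sums (r / w * 1)"
    by (intro sums_mult power_half_series)
  have sn: "summable (\<lambda>k. cmod (b k))"
    by (rule summable_comparison_test'[OF sums_summable[OF sg], of 0]) (use bd in auto)
  then show ?S by (rule summable_norm_cancel)
  have "cmod (\<Sum>k. b k) \<le> (\<Sum>k. cmod (b k))" by (rule summable_norm[OF sn])
  also have "\<dots> \<le> (\<Sum>k. r / w * (1 / 2) ^ Suc k)"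
    by (intro suminf_le bd sn sums_summable[OF sg])
  also have "\<dots> = r / w" using sums_unique[OF sg] by (simp only: mult_1_right)
  finally have "cmod (\<Sum>k. b k) * w \<le> r" using assms(2) by (simp add: field_simps)
  then have "(cmod (\<Sum>k. b k) * w) powr p \<le> r powr p"
    using assms(1,2) by (intro powr_mono2) auto
  also have "r powr p = T" using assms(1) T(2) by (simp add: r_def powr_powr)
  finally show "?L \<le> ?R" using T by (simp add: ennreal_leI)
qed

text \<open>Smallness is available only for the terms other than \<open>j\<close>, so summability of
  the whole series has to be recovered from them.\<close>

lemma suminf_minus_term:
  fixes a :: "nat \<Rightarrow> complex"
  assumes "summable (\<lambda>k. if k = j then 0 else a k)"
  shows "summable a" "suminf a - a j = (\<Sum>k. if k = j then 0 else a k)"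
proof -
  have eq: "a = (\<lambda>k. (if k = j then 0 else a k) + (if k = j then a k else 0))" by auto
  have s: "(\<lambda>k. if k = j then a k else 0) sums a j" using sums_single[of j a] by simp
  have "a sums ((\<Sum>k. if k = j then 0 else a k) + a j)"
    by (subst eq) (intro sums_add summable_sums assms s)
  then show "summable a" "suminf a - a j = (\<Sum>k. if k = j then 0 else a k)"
    by (auto simp: sums_iff)
qed

context admissible_weight
begin

text \<open>\<open>summable_of_weighted_powr\<close> at each point, integrated term by term. It
  measures how far a multiple of the whole series is from its \<open>j\<close>-th summand.\<close>

lemma pint_suminf_minus_term:
  assumes [measurable]: "\<And>k. u k \<in> borel_measurable borel" and c: "c \<noteq> 0"
  shows "pint UNIV (\<lambda>t. c * (\<Sum>k. u k t) - c * u j t)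
    \<le> (\<Sum>k. if k = j then 0 else ennreal ((2 * 2 ^ k) powr p) * pint UNIV (\<lambda>t. c * u k t))"
proof -
  let ?b = "\<lambda>k t. if k = j then 0 else c * u k t"
  let ?T = "\<lambda>k t. ennreal ((2 * 2 ^ k * cmod (?b k t) * \<omega> t) powr p)"
  have "pint UNIV (\<lambda>t. c * (\<Sum>k. u k t) - c * u j t) \<le> (\<integral>\<^sup>+t. (\<Sum>k. ?T k t) \<partial>\<mu>)"
    unfolding pint_def
  proof (rule nn_integral_mono)
    fix t
    show "ennreal ((cmod (c * (\<Sum>k. u k t) - c * u j t) * \<omega> t) powr p) * indicator UNIV t \<le> (\<Sum>k. ?T k t)"
    proof (cases "(\<Sum>k. ?T k t) < \<infinity>")
      case True
      note b = summable_of_weighted_powr[OF p_pos weight_pos True]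
      note ab = suminf_minus_term[OF b(1)]
      have "summable (\<lambda>k. u k t)" using summable_cmult_iff[of c "\<lambda>k. u k t"] ab(1) c by simp
      then have "c * (\<Sum>k. u k t) - c * u j t = (\<Sum>k. ?b k t)"
        using ab(2) by (simp add: suminf_mult)
      then show ?thesis using b(2) by simp
    next
      \<comment> \<open>The right-hand side is infinite here, so the value of \<open>suminf\<close>
        at such a point does not matter.\<close>
      case False
      then have "(\<Sum>k. ?T k t) = \<infinity>"
        unfolding infinity_ennreal_def top.not_eq_extremum[symmetric] by blast
      then show ?thesis by simp
    qed
  qed
  also have "\<dots> = (\<Sum>k. \<integral>\<^sup>+t. ?T k t \<partial>\<mu>)"
    by (rule nn_integral_suminf) measurable
  also have "\<dots> = (\<Sum>k. if k = j then 0 else ennreal ((2 * 2 ^ k) powr p) * pint UNIV (\<lambda>t. c * u k t))"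
  proof (rule suminf_cong)
    fix k
    have "cmod (c * u k t) * \<omega> t \<ge> 0" for t using weight_pos[of t] by simp
    then have T: "?T k t = ennreal ((2 * 2 ^ k) powr p) * (ennreal ((cmod (c * u k t) * \<omega> t) powr p) * indicator UNIV t)"
      if "k \<noteq> j" for t
      using that by (simp add: mult.assoc powr_mult ennreal_mult)
    show "(\<integral>\<^sup>+t. ?T k t \<partial>\<mu>) = (if k = j then 0 else ennreal ((2 * 2 ^ k) powr p) * pint UNIV (\<lambda>t. c * u k t))"
    proof (cases "k = j")
      case True then show ?thesis using p_pos by simp
    next
      case False
      have "(\<integral>\<^sup>+t. ?T k t \<partial>\<mu>) = (\<integral>\<^sup>+t. ennreal ((2 * 2 ^ k) powr p) * (ennreal ((cmod (c * u k t) * \<omega> t) powr p) * indicator UNIV t) \<partial>\<mu>)"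
        by (intro nn_integral_cong T False)
      also have "\<dots> = ennreal ((2 * 2 ^ k) powr p) * pint UNIV (\<lambda>t. c * u k t)"
        unfolding pint_def by (rule nn_integral_cmult) measurable
      finally show ?thesis using False by simp
    qed
  qed
  finally show ?thesis .
qed

text \<open>\<open>D\<close> consists of finite sums of multiples, with factors in a countable dense
  set, of indicators of \<open>F n \<inter> V\<close> with \<open>V\<close> a finite union of basic
  sets; intersecting with \<open>F n\<close> makes them tame. Density passes from Borel sets to
  simple functions to all functions.\<close>

lemma countable_tame_dense:
  obtains D where "countable D" "D \<noteq> {}" "\<And>h. h \<in> D \<Longrightarrow> tame h"
    "\<And>f. f \<in> borel_measurable borel \<Longrightarrow> pint UNIV f < \<infinity> \<Longrightarrow> f \<in> pclosure D"
proof -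
  obtain F :: "nat \<Rightarrow> 'g set" where F: "\<And>n. compact (F n)" "incseq F" "(\<Union>n. F n) = UNIV"
    "\<And>n t s. t \<in> F n \<Longrightarrow> \<omega> (t + s) \<le> real n * \<omega> s"
    "\<And>n t s. t \<in> F n \<Longrightarrow> \<omega> (- t + s) \<le> real n * \<omega> s"
    by (rule tame_exhaustion) blast
  have Fb [measurable]: "F n \<in> sets borel" for n using F(1) by (simp add: borel_compact)
  obtain B :: "'g set set" where B: "countable B" "topological_basis B"
    using ex_countable_basis by blast
  define \<V> where "\<V> = Union ` {X. finite X \<and> X \<subseteq> B}"
  have \<V>c: "countable \<V>" unfolding \<V>_def using B(1)
    by (intro countable_image countable_Collect_finite_subset)
  have \<V>b: "V \<in> sets borel" if V: "V \<in> \<V>" for V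
  proof -
    have "open V" using V topological_basis_open[OF B(2)] unfolding \<V>_def by blast
    then show ?thesis by simp
  qed
  obtain q :: "complex set" where q: "countable q" "\<And>X. open X \<Longrightarrow> X \<noteq> {} \<Longrightarrow> \<exists>d\<in>q. d \<in> X"
    by (erule countable_dense_setE)
  define E where "E = q \<times> \<V> \<times> (UNIV :: nat set)"
  define atom :: "complex \<times> 'g set \<times> nat \<Rightarrow> 'g \<Rightarrow> complex"
    where "atom x t = fst x * indicator (F (snd (snd x)) \<inter> fst (snd x)) t" for x t
  \<comment> \<open>Summing over lists gives a countable set that is closed under addition, by
    appending.\<close>
  define D where "D = (\<lambda>xs t. \<Sum>x\<leftarrow>xs. atom x t) ` lists E"
  have D_count: "countable D" unfolding D_def E_def using q(1) \<V>c
    by (intro countable_image countable_lists) auto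
  have D_zero: "(\<lambda>t. 0) \<in> D" unfolding D_def by (rule image_eqI[of _ _ "[]"]) auto
  have atom_tame: "tame (atom x)" if x: "x \<in> E" for x
  proof -
    obtain a V n where xe: "x = (a, V, n)" "V \<in> \<V>" using x by (auto simp: E_def)
    have "F n \<inter> V \<in> sets borel" using \<V>b[OF xe(2)] by simp
    then have "tame (indicator (F n \<inter> V))"
      by (rule tame_indicator[where K = "F n" and m = "real n"]) (use F in auto)
    then have "tame (\<lambda>t. a * indicator (F n \<inter> V) t)" by (rule tame_cmult)
    then show ?thesis by (simp add: atom_def[abs_def] xe)
  qed
  have D_tame: "tame h" if "h \<in> D" for h
    using that atom_tame unfolding D_def by (auto intro!: tame_sum_list)
  have D_meas: "D \<subseteq> borel_measurable borel" using D_tame tame_measurable by blast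
  have D_add: "(\<lambda>t. g t + h t) \<in> D" if gh: "g \<in> D" "h \<in> D" for g h
  proof -
    obtain xs ys where "xs \<in> lists E" "ys \<in> lists E"
      "g = (\<lambda>t. \<Sum>x\<leftarrow>xs. atom x t)" "h = (\<lambda>t. \<Sum>x\<leftarrow>ys. atom x t)"
      using gh unfolding D_def by blast
    then show ?thesis unfolding D_def by (intro image_eqI[of _ _ "xs @ ys"]) auto
  qed
  have D_atom: "atom x \<in> D" if "x \<in> E" for x
    unfolding D_def using that by (intro image_eqI[of _ _ "[x]"]) auto
  have step: "(\<lambda>t. a * indicator (F n \<inter> A) t) \<in> pclosure D"
    if A: "A \<in> sets borel" for a :: complex and n A
  proof -
    have "\<exists>h\<in>D. pint UNIV (\<lambda>t. h t - a * indicator (F n \<inter> A) t) < ennreal \<epsilon>" if \<epsilon>: "0 < \<epsilon>" for \<epsilon>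
    proof -
      define \<epsilon>' where "\<epsilon>' = \<epsilon> / (4 * 2 powr p)"
      have \<epsilon>': "0 < \<epsilon>'" using \<epsilon> by (simp add: \<epsilon>'_def)
      \<comment> \<open>An upper bound of the weight on \<open>F n\<close>; the summand 1 keeps it
        positive also for \<open>n = 0\<close>.\<close>
      define r where "r = real n * \<omega> 0 + 1"
      have r: "0 < r" using weight_pos[of 0] by (simp add: r_def add_nonneg_pos)
      have \<omega>r: "\<omega> t \<le> r" if "t \<in> F n" for t using F(4)[OF that, of 0] by (simp add: r_def)
      obtain M where M: "emeasure \<mu> (F n) = ennreal M" "0 \<le> M"
        using emeasure_compact[OF F(1), of n] by (cases "emeasure \<mu> (F n)") auto
      have bound: "pint UNIV (\<lambda>t. b * g t) \<le> ennreal ((cmod b * r) powr p) * emeasure \<mu> Y"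
        if "Y \<in> sets borel" "\<And>t. cmod (g t) \<le> indicator Y t" "Y \<subseteq> F n" for b Y and g :: "'g \<Rightarrow> complex"
      proof -
        have "pint UNIV (\<lambda>t. b * g t) \<le> (\<integral>\<^sup>+t. ennreal ((cmod b * r) powr p) * indicator Y t \<partial>\<mu>)"
          unfolding pint_def
        proof (rule nn_integral_mono)
          fix t
          show "ennreal ((cmod (b * g t) * \<omega> t) powr p) * indicator UNIV t
              \<le> ennreal ((cmod b * r) powr p) * indicator Y t"
          proof (cases "t \<in> Y")
            case True
            then have "cmod (b * g t) \<le> cmod b * 1"
              unfolding norm_mult using that(2)[of t] by (intro mult_left_mono) auto
            then have "cmod (b * g t) * \<omega> t \<le> cmod b * r"
              using \<omega>r[of t] that(3) True weight_pos[of t] by (intro mult_mono) auto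
            then show ?thesis using True weight_pos[of t] p_pos
              by (auto intro!: ennreal_leI powr_mono2)
          next
            case False
            then have "g t = 0" using that(2)[of t] by simp
            then show ?thesis using p_pos by simp
          qed
        qed
        also have "\<dots> = ennreal ((cmod b * r) powr p) * emeasure \<mu> Y"
          using that(1) by (simp add: nn_integral_cmult_indicator)
        finally show ?thesis .
      qed
      \<comment> \<open>Chosen so that (\<eta> r)^p M stays below \<epsilon>'; \<open>M + 1\<close>
        avoids a division by zero when \<open>F n\<close> is null.\<close>
      define \<eta> where "\<eta> = (\<epsilon>' / (2 * (M + 1))) powr (1 / p) / r"
      have \<eta>: "0 < \<eta>" using \<epsilon>' M r by (simp add: \<eta>_def)
      obtain b where b: "b \<in> q" "cmod (b - a) < \<eta>"
        using q(2)[of "ball a \<eta>"] \<eta> by (auto simp: dist_norm norm_minus_commute)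
      have "(cmod (b - a) * r) powr p \<le> (\<eta> * r) powr p"
        using b(2) r p_pos by (intro powr_mono2 mult_right_mono) auto
      also have "\<dots> = \<epsilon>' / (2 * (M + 1))"
        using r \<epsilon>' M p_pos by (simp add: \<eta>_def powr_powr)
      finally have "(cmod (b - a) * r) powr p * M \<le> \<epsilon>' / (2 * (M + 1)) * M"
        using M by (intro mult_right_mono) auto
      also have "\<dots> < \<epsilon>'"
      proof -
        have "0 < M * \<epsilon>' + \<epsilon>' * 2" using M \<epsilon>' by (intro add_nonneg_pos) auto
        then show ?thesis using M \<epsilon>' by (simp add: field_simps)
      qed
      finally have small: "(cmod (b - a) * r) powr p * M < \<epsilon>'" .
      have "pint UNIV (\<lambda>t. (b - a) * indicator (F n \<inter> A) t)
          \<le> ennreal ((cmod (b - a) * r) powr p) * emeasure \<mu> (F n)"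
        by (rule bound) (auto split: split_indicator)
      also have "\<dots> < ennreal \<epsilon>'"
        using small M \<epsilon>' by (simp add: ennreal_mult[symmetric] ennreal_less_iff)
      finally have 1: "pint UNIV (\<lambda>t. (b - a) * indicator (F n \<inter> A) t) < ennreal \<epsilon>'" .
      \<comment> \<open>The set is approximated only after \<open>b\<close> is fixed, so the
        tolerance may depend on |b|.\<close>
      define R where "R = (cmod b * r) powr p"
      have R: "0 \<le> R" by (simp add: R_def)
      have FA: "emeasure \<mu> (F n \<inter> A) < \<infinity>"
        using emeasure_mono[of "F n \<inter> A" "F n" \<mu>] emeasure_compact[OF F(1), of n]
          by (auto intro: le_less_trans)
      have FAb: "F n \<inter> A \<in> sets borel" using A by simp
      obtain \<X> where \<X>: "finite \<X>" "\<X> \<subseteq> B"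
        "emeasure \<mu> ((\<Union>\<X> - (F n \<inter> A)) \<union> ((F n \<inter> A) - \<Union>\<X>)) < ennreal (\<epsilon>' / (R + 1))"
        using finite_union_approximation[OF B(2) FAb FA, of "\<epsilon>' / (R + 1)"] \<epsilon>' R
        by (metis add_nonneg_pos divide_pos_pos zero_less_one)
      define V where "V = \<Union>\<X>"
      have V: "V \<in> \<V>" using \<X> by (auto simp: V_def \<V>_def)
      note [measurable] = \<V>b[OF V] A
      \<comment> \<open>Only the error inside \<open>F n\<close> counts, and there the weight is at
        most \<open>r\<close>.\<close>
      let ?Y = "F n \<inter> ((V - (F n \<inter> A)) \<union> ((F n \<inter> A) - V))"
      have "pint UNIV (\<lambda>t. b * (indicator (F n \<inter> V) t - indicator (F n \<inter> A) t)) \<le> ennreal R * emeasure \<mu> ?Y"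
        unfolding R_def by (rule bound) (auto split: split_indicator)
      also have "\<dots> \<le> ennreal R * ennreal (\<epsilon>' / (R + 1))"
      proof (intro mult_left_mono)
        have "emeasure \<mu> ?Y \<le> emeasure \<mu> ((V - (F n \<inter> A)) \<union> ((F n \<inter> A) - V))"
          by (intro emeasure_mono) auto
        then show "emeasure \<mu> ?Y \<le> ennreal (\<epsilon>' / (R + 1))"
          using \<X>(3) by (simp add: V_def)
      qed simp
      also have "\<dots> < ennreal \<epsilon>'"
        using R \<epsilon>' by (simp add: ennreal_mult[symmetric] ennreal_less_iff field_simps)
      finally have 2: "pint UNIV (\<lambda>t. b * (indicator (F n \<inter> V) t - indicator (F n \<inter> A) t)) < ennreal \<epsilon>'" .
      have "pint UNIV (\<lambda>t. atom (b, V, n) t - a * indicator (F n \<inter> A) t) < ennreal \<epsilon>"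
      proof (rule pint_triangle_less[OF _ _ _ \<epsilon> 2[unfolded \<epsilon>'_def] 1[unfolded \<epsilon>'_def]])
        fix t
        show "cmod (atom (b, V, n) t - a * indicator (F n \<inter> A) t)
          \<le> cmod (b * (indicator (F n \<inter> V) t - indicator (F n \<inter> A) t)) + cmod ((b - a) * indicator (F n \<inter> A) t)"
          using norm_triangle_ineq[of "b * (indicator (F n \<inter> V) t - indicator (F n \<inter> A) t)" "(b - a) * indicator (F n \<inter> A) t"]
          by (simp add: atom_def algebra_simps)
      qed measurable
      moreover have "atom (b, V, n) \<in> D" using b V by (intro D_atom) (simp add: E_def)
      ultimately show ?thesis by blast
    qed
    moreover have "(\<lambda>t. a * indicator (F n \<inter> A) t) \<in> borel_measurable borel" using A by measurable
    ultimately show ?thesis by (simp add: pclosure_def)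
  qed
  have simple: "(\<lambda>t. s t * indicator (F n) t) \<in> pclosure D"
    if s: "simple_function \<mu> s" for s :: "'g \<Rightarrow> complex" and n
  proof -
    have fin: "finite (range s)" using simple_functionD(1)[OF s] by simp
    have "s t * indicator (F n) t = (\<Sum>y\<in>range s. y * indicator (F n \<inter> s -` {y}) t)" for t
    proof -
      have "(\<Sum>y\<in>range s. y * indicator (F n \<inter> s -` {y}) t) = (\<Sum>y\<in>range s. if y = s t then s t * indicator (F n) t else 0)"
        by (intro sum.cong) (auto split: split_indicator)
      then show ?thesis using fin by simp
    qed
    moreover have "(\<lambda>t. \<Sum>y\<in>range s. y * indicator (F n \<inter> s -` {y}) t) \<in> pclosure D"
    proof (rule pclosure_sum[OF D_meas D_add D_zero fin])
      fix y assume "y \<in> range s"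
      have "s -` {y} \<in> sets borel" using simple_functionD(2)[OF s, of "{y}"] by simp
      then show "(\<lambda>t. y * indicator (F n \<inter> s -` {y}) t) \<in> pclosure D" by (rule step)
    qed
    ultimately show ?thesis by simp
  qed
  have "f \<in> pclosure D" if f: "f \<in> borel_measurable borel" "pint UNIV f < \<infinity>" for f
  proof (rule pclosure_closed[OF D_meas f(1)])
    fix \<epsilon> :: real assume \<epsilon>: "0 < \<epsilon>"
    have "f \<in> borel_measurable \<mu>" using f(1) by (simp cong: measurable_cong_sets)
    from borel_measurable_implies_sequence_metric[OF this, of 0]
    obtain s where s: "\<And>i. simple_function \<mu> (s i)" "\<And>x. (\<lambda>i. s i x) \<longlonglongrightarrow> f x"
      "\<And>i x. cmod (s i x) \<le> 2 * cmod (f x)"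
      by auto
    \<comment> \<open>The cut to \<open>F i\<close> puts the approximants into the closure.
      Pointwise limits survive, because each point lies in all late \<open>F i\<close>.\<close>
    define v where "v i t = s i t * indicator (F i) t" for i t
    have vcl: "v i \<in> pclosure D" for i unfolding v_def by (rule simple[OF s(1)])
    have "(\<lambda>i. pint UNIV (\<lambda>t. v i t - f t)) \<longlonglongrightarrow> 0"
    proof (rule pint_dominated[OF _ f(1) _ _ f(2)])
      show "v i \<in> borel_measurable borel" for i using vcl[of i] by (simp add: pclosure_def)
      show "(\<lambda>i. v i t) \<longlonglongrightarrow> f t" for t
      proof -
        obtain n where n: "t \<in> F n" using F(3) by blast
        have "\<forall>\<^sub>F i in sequentially. s i t = v i t"
          using eventually_ge_at_top[of n]
        proof eventually_elim
          case (elim i)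
          then have "t \<in> F i" using n F(2) by (auto simp: incseq_def)
          then show ?case by (simp add: v_def)
        qed
        then show ?thesis using s(2)[of t] by (rule Lim_transform_eventually[rotated])
      qed
      show "cmod (v i t) \<le> 2 * cmod (f t)" for i t
        using s(3)[of i t] by (auto simp: v_def norm_mult split: split_indicator)
    qed
    then have "\<forall>\<^sub>F i in sequentially. pint UNIV (\<lambda>t. v i t - f t) < ennreal \<epsilon>"
      using \<epsilon> by (intro order_tendstoD) auto
    then obtain i where "pint UNIV (\<lambda>t. v i t - f t) < ennreal \<epsilon>"
      by (auto simp: eventually_sequentially)
    then show "\<exists>g\<in>pclosure D. pint UNIV (\<lambda>t. g t - f t) < ennreal \<epsilon>" using vcl by blast
  qed
  then show thesis using that[OF D_count _ D_tame] D_zero by blast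
qed

section \<open>Sufficiency: construction of the dense vector\<close>

lemma eventually_small_powr:
  assumes "x \<longlonglongrightarrow> 0" "\<And>n. 0 \<le> x n" "0 < e"
  shows "\<forall>\<^sub>F n in sequentially. A * x n powr p \<le> (e :: real)"
proof -
  have "(\<lambda>n. x n powr p) \<longlonglongrightarrow> 0 powr p"
    using assms p_pos by (intro tendsto_powr' tendsto_const) auto
  from tendsto_mult[OF tendsto_const[of A] this]
  have "(\<lambda>n. A * x n powr p) \<longlonglongrightarrow> 0" using p_pos by simp
  then have "\<forall>\<^sub>F n in sequentially. A * x n powr p < e"
    using assms(3) by (intro order_tendstoD)
  then show ?thesis by eventually_elim simp
qed

lemma small_imp_dense_vector:
  assumes s: "\<And>n. s n \<in> S" and c: "\<And>n. c n \<in> \<Gamma> - {0}"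
    and l1: "(\<lambda>n. cmod (c n) * \<omega> (s n)) \<longlonglongrightarrow> 0" and l2: "(\<lambda>n. \<omega> (- s n) / cmod (c n)) \<longlonglongrightarrow> 0"
  shows "\<exists>f. dense_vector \<mu> p \<omega> \<Gamma> S f"
proof -
  obtain D where D: "countable D" "D \<noteq> {}" "\<And>h. h \<in> D \<Longrightarrow> tame h"
    "\<And>f. f \<in> borel_measurable borel \<Longrightarrow> pint UNIV f < \<infinity> \<Longrightarrow> f \<in> pclosure D"
    by (rule countable_tame_dense) blast
  \<comment> \<open>Through \<open>prod_decode\<close> every member of \<open>D\<close> occurs at
    infinitely many indices.\<close>
  define g where "g k = from_nat_into D (fst (prod_decode k))" for k
  have gD: "g k \<in> D" for k unfolding g_def by (rule from_nat_into[OF D(2)])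
  have gt: "tame (g k)" for k using D(3) gD by blast
  have c0: "c n \<noteq> 0" for n using c[of n] by simp
  \<comment> \<open>A factor 2^k of the decay is spent on the weights in
    \<open>pint_suminf_minus_term\<close>; the rest leaves decay in both indices.\<close>
  define e :: "nat \<Rightarrow> real" where "e k = ((1 / 8) ^ k) powr p" for k
  have e: "0 < e k" for k by (simp add: e_def)
  define u where "u k n = (\<lambda>t. inverse (c n) * left_translation (- s n) (g k) t)" for k n
  have ut: "tame (u k n)" for k n unfolding u_def by (intro tame_cmult tame_translation gt)
  \<comment> \<open>For \<open>j < k\<close> the first condition makes the old summand small at the
    new stage, the second makes the new summand small at the old stage.\<close>
  define Q where "Q j k m n \<longleftrightarrow>
    pint UNIV (\<lambda>t. c n * left_translation (s n) (u j m) t) \<le> ennreal (e k) \<and>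
    pint UNIV (\<lambda>t. c m * left_translation (s m) (u k n) t) \<le> ennreal (e k)" for j k m n
  have "\<forall>\<^sub>F n in sequentially. Q j k m n" for j k m
  proof -
    \<comment> \<open>The limit \<open>l1\<close> acts on the tame function \<open>u j m\<close>;
      the limit \<open>l2\<close> acts on \<open>g k\<close> after the old stage has been applied to
      it.\<close>
    obtain A where A: "0 \<le> A" "\<And>s. pint UNIV (left_translation s (u j m)) \<le> ennreal (A * \<omega> s powr p)"
      using tameE[OF ut] by blast
    have tB: "tame (\<lambda>t. c m * left_translation (s m) (g k) t)"
      by (intro tame_cmult tame_translation gt)
    obtain B where B: "0 \<le> B" "\<And>v. pint UNIV (left_translation v (\<lambda>t. c m * left_translation (s m) (g k) t)) \<le> ennreal (B * \<omega> v powr p)"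
      using tameE[OF tB] by blast
    have "\<forall>\<^sub>F n in sequentially. A * (cmod (c n) * \<omega> (s n)) powr p \<le> e k"
      by (intro eventually_small_powr l1 e) (simp add: weight_pos less_imp_le)
    moreover have "\<forall>\<^sub>F n in sequentially. B * (\<omega> (- s n) / cmod (c n)) powr p \<le> e k"
      by (intro eventually_small_powr l2 e) (simp add: weight_pos less_imp_le)
    ultimately show ?thesis
    proof eventually_elim
      case (elim n)
      have "pint UNIV (\<lambda>t. c n * left_translation (s n) (u j m) t)
          = ennreal (cmod (c n) powr p) * pint UNIV (left_translation (s n) (u j m))"
        using tame_measurable[OF ut] by (intro pint_cmult left_translation_measurable) auto
      also have "\<dots> \<le> ennreal (cmod (c n) powr p) * ennreal (A * \<omega> (s n) powr p)"
        by (intro mult_left_mono A) simp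
      also have "\<dots> = ennreal (A * (cmod (c n) * \<omega> (s n)) powr p)"
        using A(1) weight_pos[of "s n"] by (simp add: ennreal_mult[symmetric] powr_mult mult_ac)
      also have "\<dots> \<le> ennreal (e k)" by (intro ennreal_leI elim)
      finally have 1: "pint UNIV (\<lambda>t. c n * left_translation (s n) (u j m) t) \<le> ennreal (e k)" .
      \<comment> \<open>Translations commute, so the old stage can be moved inside and the inverse
        of the new one applied last.\<close>
      have "(\<lambda>t. c m * left_translation (s m) (u k n) t)
          = (\<lambda>t. inverse (c n) * left_translation (- s n) (\<lambda>t. c m * left_translation (s m) (g k) t) t)"
        by (simp add: u_def left_translation_def fun_eq_iff algebra_simps)
      then have "pint UNIV (\<lambda>t. c m * left_translation (s m) (u k n) t)
          = ennreal (cmod (inverse (c n)) powr p) * pint UNIV (left_translation (- s n) (\<lambda>t. c m * left_translation (s m) (g k) t))"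
        using tame_measurable[OF tB]
          by (simp only:) (intro pint_cmult left_translation_measurable, auto)
      also have "\<dots> \<le> ennreal (cmod (inverse (c n)) powr p) * ennreal (B * \<omega> (- s n) powr p)"
        by (intro mult_left_mono B) simp
      also have "\<dots> = ennreal (B * (\<omega> (- s n) / cmod (c n)) powr p)"
        using B(1) weight_pos[of "- s n"] c0[of n]
        by (simp add: ennreal_mult[symmetric] divide_inverse norm_inverse powr_mult mult_ac)
      also have "\<dots> \<le> ennreal (e k)" by (intro ennreal_leI elim)
      finally show ?case using 1 by (simp add: Q_def)
    qed
  qed
  then obtain r where r: "\<And>j k. j < k \<Longrightarrow> Q j k (r j) (r k)"
    using diagonal_choice[of Q] by blast
  define f where "f t = (\<Sum>k. u k (r k) t)" for t
  have um [measurable]: "u k n \<in> borel_measurable borel" for k n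
    using tame_measurable[OF ut] .
  have fm [measurable]: "f \<in> borel_measurable borel" unfolding f_def by measurable
  have near: "pint UNIV (\<lambda>t. c (r j) * left_translation (s (r j)) f t - g j t) \<le> ennreal (4 * (1 / 2) ^ j)" for j
  proof -
    let ?c = "c (r j)" and ?s = "s (r j)"
    have uj: "?c * left_translation ?s (u j (r j)) t = g j t" for t
      using c0[of "r j"] by (simp add: u_def left_translation_def algebra_simps)
    have term_le: "(if k = j then 0 else ennreal ((2 * 2 ^ k) powr p) * pint UNIV (\<lambda>t. ?c * left_translation ?s (u k (r k)) t))
        \<le> ennreal (4 * (1 / 2) ^ j * (1 / 2) ^ Suc k)" for k
    proof (cases "k = j")
      case False
      have "pint UNIV (\<lambda>t. ?c * left_translation ?s (u k (r k)) t) \<le> ennreal (e (max j k))"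
        using False r[of j k] r[of k j] by (cases "j < k") (auto simp: Q_def max_def)
      then have "ennreal ((2 * 2 ^ k) powr p) * pint UNIV (\<lambda>t. ?c * left_translation ?s (u k (r k)) t)
          \<le> ennreal ((2 * 2 ^ k) powr p) * ennreal (e (max j k))"
        by (intro mult_left_mono) auto
      also have "\<dots> = ennreal ((2 * 2 ^ k * (1 / 8) ^ max j k) powr p)"
        by (simp add: e_def ennreal_mult[symmetric] powr_mult)
      \<comment> \<open>Three times max(j,k) is at least j + 2k, so the base is at most 2 times
        2^-(j+k). As j \<noteq> k this is at most 1, and a power p \<ge> 1 only decreases
        it.\<close>
      also have "\<dots> \<le> ennreal (4 * (1 / 2) ^ j * (1 / 2) ^ Suc k)"
      proof (rule ennreal_leI)
        have "(1 / 8 :: real) ^ max j k = (1 / 2) ^ (3 * max j k)"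
          by (simp add: power_mult power3_eq_cube)
        also have "\<dots> \<le> (1 / 2) ^ (j + k + k)"
          by (rule power_decreasing) auto
        finally have "2 * 2 ^ k * (1 / 8 :: real) ^ max j k \<le> 2 * 2 ^ k * (1 / 2) ^ (j + k + k)"
          by (intro mult_left_mono) auto
        also have "\<dots> = 2 * (1 / 2) ^ (j + k)"
          by (simp add: power_add power_one_over field_simps)
        finally have le: "2 * 2 ^ k * (1 / 8 :: real) ^ max j k \<le> 2 * (1 / 2) ^ (j + k)" .
        have "(1 / 2 :: real) ^ (j + k) \<le> (1 / 2) ^ 1"
          using False by (intro power_decreasing) auto
        then have le1: "2 * (1 / 2 :: real) ^ (j + k) \<le> 1" by simp
        have "(2 * 2 ^ k * (1 / 8 :: real) ^ max j k) powr p \<le> (2 * (1 / 2) ^ (j + k)) powr p"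
          using le p_pos by (intro powr_mono2) auto
        also have "\<dots> \<le> (2 * (1 / 2) ^ (j + k)) powr 1"
          using le1 p_ge_1 by (intro powr_mono') auto
        also have "\<dots> = 4 * (1 / 2) ^ j * (1 / 2) ^ Suc k"
          by (simp add: power_add)
        finally show "(2 * 2 ^ k * (1 / 8 :: real) ^ max j k) powr p \<le> 4 * (1 / 2) ^ j * (1 / 2) ^ Suc k" .
      qed
      finally show ?thesis using False by simp
    qed simp
    have sg: "(\<lambda>k. 4 * (1 / 2 :: real) ^ j * (1 / 2) ^ Suc k) sums (4 * (1 / 2) ^ j * 1)"
      by (intro sums_mult power_half_series)
    have "pint UNIV (\<lambda>t. ?c * left_translation ?s f t - g j t)
        = pint UNIV (\<lambda>t. ?c * (\<Sum>k. left_translation ?s (u k (r k)) t) - ?c * left_translation ?s (u j (r j)) t)"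
      by (simp only: uj) (simp add: left_translation_def f_def)
    also have "\<dots> \<le> (\<Sum>k. if k = j then 0 else ennreal ((2 * 2 ^ k) powr p) * pint UNIV (\<lambda>t. ?c * left_translation ?s (u k (r k)) t))"
      by (intro pint_suminf_minus_term c0 left_translation_measurable um)
    also have "\<dots> \<le> (\<Sum>k. ennreal (4 * (1 / 2) ^ j * (1 / 2) ^ Suc k))"
      by (intro suminf_le term_le) auto
    also have "\<dots> = ennreal (\<Sum>k. 4 * (1 / 2) ^ j * (1 / 2) ^ Suc k)"
      by (rule suminf_ennreal2[OF _ sums_summable[OF sg]]) simp
    also have "(\<Sum>k. 4 * (1 / 2) ^ j * (1 / 2) ^ Suc k) = (4 * (1 / 2) ^ j :: real)"
      using sums_unique[OF sg] by (simp only: mult_1_right)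
    finally show ?thesis .
  qed
  \<comment> \<open>Stage 0 takes \<open>f\<close> to within finite distance of \<open>g 0\<close>;
    undoing that stage gives finiteness of \<open>f\<close> itself.\<close>
  have f_fin: "pint UNIV f < \<infinity>"
  proof -
    let ?c = "c (r 0)" and ?s = "s (r 0)"
    have "pint UNIV (\<lambda>t. ?c * left_translation ?s f t)
        \<le> ennreal (2 powr p) * (pint UNIV (\<lambda>t. ?c * left_translation ?s f t - g 0 t) + pint UNIV (g 0))"
      using tame_measurable[OF gt]
      by (intro pint_triangle borel_measurable_diff borel_measurable_times borel_measurable_const left_translation_measurable fm)
        (auto simp: norm_triangle_sub add.commute)
    also have "\<dots> < \<infinity>"
      using near[of 0] tame_pint_finite[OF gt, of 0]
        by (auto simp: ennreal_mult_less_top intro: le_less_trans)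
    finally have "pint UNIV (\<lambda>t. inverse ?c * left_translation (- ?s) (\<lambda>t. ?c * left_translation ?s f t) t) < \<infinity>"
      by (rule pint_translation_finite[rotated])
        (intro borel_measurable_times borel_measurable_const left_translation_measurable fm)
    then show ?thesis
      using c0[of "r 0"] by (simp add: left_translation_def mult.assoc[symmetric])
  qed
  have "\<exists>a\<in>\<Gamma>. \<exists>v\<in>S. pint UNIV (\<lambda>t. a * left_translation v f t - h t) < ennreal \<epsilon>"
    if h: "h \<in> borel_measurable borel" "pint UNIV h < \<infinity>" and \<epsilon>: "0 < \<epsilon>" for h \<epsilon>
  proof -
    define \<epsilon>' where "\<epsilon>' = \<epsilon> / (4 * 2 powr p)"
    have \<epsilon>': "0 < \<epsilon>'" using \<epsilon> by (simp add: \<epsilon>'_def)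
    obtain d where d: "d \<in> D" "pint UNIV (\<lambda>t. d t - h t) < ennreal \<epsilon>'"
      using D(4)[OF h] \<epsilon>' unfolding pclosure_def by blast
    obtain i where i: "from_nat_into D i = d" using from_nat_into_surj[OF D(1) d(1)] by blast
    obtain m where m: "(1 / 2 :: real) ^ m < \<epsilon>' / 4"
      using real_arch_pow_inv[of "\<epsilon>' / 4" "1 / 2"] \<epsilon>' by auto
    \<comment> \<open>This index encodes \<open>d\<close> and, being at least \<open>m\<close>, is
      late enough for the rate in \<open>near\<close>.\<close>
    define k where "k = prod_encode (i, m)"
    have "m \<le> k" unfolding k_def by (rule le_prod_encode_2)
    then have "(1 / 2 :: real) ^ k \<le> (1 / 2) ^ m" by (intro power_decreasing) auto
    with m have "4 * (1 / 2 :: real) ^ k < \<epsilon>'" by linarith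
    then have nk: "pint UNIV (\<lambda>t. c (r k) * left_translation (s (r k)) f t - g k t) < ennreal \<epsilon>'"
      using near[of k] \<epsilon>' by (auto intro: le_less_trans simp: ennreal_less_iff)
    have gk: "g k = d" by (simp add: g_def k_def i)
    note [measurable] = h(1) tame_measurable[OF gt] tame_measurable[OF D(3)[OF d(1)]]
    have "pint UNIV (\<lambda>t. c (r k) * left_translation (s (r k)) f t - h t) < ennreal \<epsilon>"
    proof (rule pint_triangle_less[OF _ _ _ \<epsilon> nk[unfolded \<epsilon>'_def] d(2)[unfolded \<epsilon>'_def]])
      fix t
      show "cmod (c (r k) * left_translation (s (r k)) f t - h t)
        \<le> cmod (c (r k) * left_translation (s (r k)) f t - g k t) + cmod (d t - h t)"
        using norm_triangle_ineq[of "c (r k) * left_translation (s (r k)) f t - g k t" "d t - h t"]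
        by (simp add: gk)
    qed measurable
    then show ?thesis using s[of "r k"] c[of "r k"] by blast
  qed
  then show ?thesis using fm f_fin by (auto simp: dense_vector_iff intro!: exI[of _ f])
qed

end

theorem proposition1p4:
  fixes \<mu> :: "'g::{topological_ab_group_add, t2_space, second_countable_topology} measure"
    and \<omega> :: "'g \<Rightarrow> real"
    and S :: "'g set"
    and \<Gamma> :: "complex set"
    and p :: real
  assumes "locally_compact_space (euclidean :: 'g topology)"
    and "\<not> compact (UNIV :: 'g set)"
    and "left_haar_measure \<mu>"
    and "1 \<le> p"
    and "\<Gamma> - {0} \<noteq> {}"
    and "weight \<mu> p \<omega>"
    and "continuous_on UNIV \<omega>"
    and "admissible \<mu> \<omega>"
  shows "(\<exists>f. dense_vector \<mu> p \<omega> \<Gamma> S f) \<longleftrightarrow>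
    (\<exists>(s :: nat \<Rightarrow> 'g) (c :: nat \<Rightarrow> complex).
       (\<forall>n. s n \<in> S) \<and> (\<forall>n. c n \<in> \<Gamma> - {0}) \<and>
       (\<lambda>n. max (cmod (c n) * \<omega> (s n)) (1 / cmod (c n) * \<omega> (- s n))) \<longlonglongrightarrow> 0)"
proof -
  interpret admissible_weight \<mu> p \<omega>
    using assms by unfold_locales
  show ?thesis
  proof
    assume "\<exists>f. dense_vector \<mu> p \<omega> \<Gamma> S f"
    then obtain f where f: "dense_vector \<mu> p \<omega> \<Gamma> S f" by blast
    \<comment> \<open>Taking \<eta> = 1/(n+1) for each \<open>n\<close> yields the two
      sequences.\<close>
    have "\<exists>s c. s \<in> S \<and> c \<in> \<Gamma> - {0} \<and> cmod c * \<omega> s < inverse (real (Suc n)) \<and> \<omega> (- s) / cmod c < inverse (real (Suc n))" for n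
      using dense_vector_imp_small[OF assms(2) f, of "inverse (real (Suc n))"] by auto
    then obtain s c where sc: "\<And>n. s n \<in> S" "\<And>n. c n \<in> \<Gamma> - {0}"
      "\<And>n. cmod (c n) * \<omega> (s n) < inverse (real (Suc n))" "\<And>n. \<omega> (- s n) / cmod (c n) < inverse (real (Suc n))"
      by metis
    have "(\<lambda>n. max (cmod (c n) * \<omega> (s n)) (1 / cmod (c n) * \<omega> (- s n))) \<longlonglongrightarrow> 0"
    proof (rule tendsto_sandwich[OF _ _ tendsto_const LIMSEQ_inverse_real_of_nat])
      show "\<forall>\<^sub>F n in sequentially. 0 \<le> max (cmod (c n) * \<omega> (s n)) (1 / cmod (c n) * \<omega> (- s n))"
        by (intro always_eventually allI max.coboundedI1) (simp add: weight_pos less_imp_le)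
      show "\<forall>\<^sub>F n in sequentially. max (cmod (c n) * \<omega> (s n)) (1 / cmod (c n) * \<omega> (- s n)) \<le> inverse (real (Suc n))"
        by (intro always_eventually allI max.boundedI less_imp_le) (use sc(3,4) in \<open>simp_all\<close>)
    qed
    then show "\<exists>(s :: nat \<Rightarrow> 'g) (c :: nat \<Rightarrow> complex).
       (\<forall>n. s n \<in> S) \<and> (\<forall>n. c n \<in> \<Gamma> - {0}) \<and>
       (\<lambda>n. max (cmod (c n) * \<omega> (s n)) (1 / cmod (c n) * \<omega> (- s n))) \<longlonglongrightarrow> 0"
      using sc(1,2) by blast
  next
    assume "\<exists>(s :: nat \<Rightarrow> 'g) (c :: nat \<Rightarrow> complex).
       (\<forall>n. s n \<in> S) \<and> (\<forall>n. c n \<in> \<Gamma> - {0}) \<and>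
       (\<lambda>n. max (cmod (c n) * \<omega> (s n)) (1 / cmod (c n) * \<omega> (- s n))) \<longlonglongrightarrow> 0"
    then obtain s :: "nat \<Rightarrow> 'g" and c where sc: "\<And>n. s n \<in> S" "\<And>n. c n \<in> \<Gamma> - {0}"
      and l: "(\<lambda>n. max (cmod (c n) * \<omega> (s n)) (1 / cmod (c n) * \<omega> (- s n))) \<longlonglongrightarrow> 0" by blast
    show "\<exists>f. dense_vector \<mu> p \<omega> \<Gamma> S f"
    proof (rule small_imp_dense_vector[OF sc])
      show "(\<lambda>n. cmod (c n) * \<omega> (s n)) \<longlonglongrightarrow> 0"
        by (rule tendsto_sandwich[OF _ _ tendsto_const l]) (auto simp: weight_pos less_imp_le)
      show "(\<lambda>n. \<omega> (- s n) / cmod (c n)) \<longlonglongrightarrow> 0"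
        by (rule tendsto_sandwich[OF _ _ tendsto_const l]) (auto simp: weight_pos less_imp_le)
    qed
  qed
qed

end
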